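(* Let $n \geq 3$ and let $D \subset \mathbb{C}^n$ be a bounded visibility domain (with respect to the Kobayashi distance). Let $\mathcal{A} \subsetneq \mathbb{R}^2$ be a pseudo-arc and let $A \subsetneq D$ be the image of $\mathcal{A}$ under a bi-Lipschitz map $\psi : \mathcal{A} \to \mathbb{R}^{2n}$ (where $\mathbb{C}^n$ is identified with $\mathbb{R}^{2n}$). Then $\Omega := D \setminus A$ is a visibility domain that is not pseudoconvex. In particular, $\Omega$ is not Kobayashi complete.
   Context: A pseudo-arc is a compact connected subset $\mathcal{A} \subsetneq \mathbb{R}^2$ that contains at least two points and has the property that no compact connected subset of $\mathcal{A}$ can be expressed as a union of two non-empty proper subsets (of that compact connected subset) that are both compact and connected. Bi-Lipschitz is with respect to the Euclidean distances, i.e. $\psi$ is a Lipschitz injection whose inverse $\psi(\mathcal{A}) \to \mathcal{A}$ is Lipschitz. A domain is a non-empty connected open set. For a domain $\Omega \subset \mathbb{C}^n$, $K_\Omega$ denotes the Kobayashi pseudodistance on $\Omega$ and $k_\Omega : \Omega \times \mathbb{C}^n \to [0,\infty)$ the Kobayashi(--Royden) pseudometric, $k_\Omega(z;v) = \inf\{|\zeta| : \exists\, f:\mathbb{D}\to\Omega \text{ holomorphic},\ f(0)=z,\ f'(0)\zeta = v\}$, where $\mathbb{D}$ is the open unit disc (so $K_\Omega$ is the integrated form of $k_\Omega$). When $\Omega$ is bounded, $K_\Omega$ is a genuine distance. $\Omega$ is called Kobayashi complete if the metric space $(\Omega, K_\Omega)$ is Cauchy-complete. Almost-geodesics: let $I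 \subset \mathbb{R}$ be an interval, $\lambda \geq 1$, $\kappa \geq 0$. A curve $\sigma : I \to \Omega$ is a $(\lambda,\kappa)$-almost-geodesic if (i) $\lambda^{-1}|t-s| - \kappa \leq K_\Omega(\sigma(s),\sigma(t)) \leq \lambda|t-s| + \kappa$ for all $s,t \in I$, and (ii) $\sigma$ is absolutely continuous (so $\sigma'(t)$ exists for almost every $t\in I$) and $k_\Omega(\sigma(t);\sigma'(t)) \leq \lambda$ for almost every $t \in I$. Visibility domain: a bounded domain $\Omega \subset \mathbb{C}^n$ is a visibility domain (with respect to the Kobayashi distance) if for any $\lambda \geq 1$, $\kappa \geq 0$, each pair of distinct points $\xi,\eta \in \partial\Omega$, and each pair of relatively open subsets $V_\xi, V_\eta$ of $\overline{\Omega}$ that are neighbourhoods of $\xi,\eta$ respectively with $\overline{V_\xi} \cap \overline{V_\eta} = \emptyset$, there exists a compact subset $K \subset \Omega$ such that the image of any $(\lambda,\kappa)$-almost-geodesic $\sigma : [a,b] \to \Omega$ with $\sigma(a) \in V_\xi$, $\sigma(b) \in V_\eta$ intersects $K$. Pseudoconvex is in the usual sense (equivalently, being a domain of holomorphy). *)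

theory Defs
  imports "HOL-Analysis.Analysis"
begin

definition is_domain :: "'a::topological_space set \<Rightarrow> bool" where
  "is_domain S \<longleftrightarrow> open S \<and> connected S \<and> S \<noteq> {}"


section \<open>Pseudo-arcs and bi-Lipschitz maps\<close>

definition pseudo_arc :: "(real ^ 2) set \<Rightarrow> bool" where
  "pseudo_arc P \<longleftrightarrow>
     P \<subset> UNIV \<and> compact P \<and> connected P \<and> (\<exists>x\<in>P. \<exists>y\<in>P. x \<noteq> y) \<and>
     (\<forall>C\<subseteq>P. compact C \<and> connected C \<longrightarrow>
        \<not> (\<exists>E F. E \<noteq> {} \<and> E \<subset> C \<and> compact E \<and> connected E \<and>
                 F \<noteq> {} \<and> F \<subset> C \<and> compact F \<and> connected F \<and> C = E \<union> F))"

definition bi_lipschitz_on :: "'a::metric_space set \<Rightarrow> ('a \<Rightarrow> 'b::metric_space) \<Rightarrow> bool" where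
  "bi_lipschitz_on S f \<longleftrightarrow>
     inj_on f S \<and> (\<exists>L. lipschitz_on L S f) \<and> (\<exists>M. lipschitz_on M (f ` S) (inv_into S f))"


section \<open>The Kobayashi pseudometric and pseudodistance\<close>

text \<open>\<open>\<complex>\<^sup>n\<close> is \<open>complex ^ 'n\<close> with \<open>n = CARD('n)\<close>; its norm is the Euclidean norm of \<open>\<real>\<^bsup>2n\<^esup>\<close>.\<close>

definition holomorphic_disc :: "(complex ^ 'n) set \<Rightarrow> (complex \<Rightarrow> complex ^ 'n) \<Rightarrow> bool" where
  "holomorphic_disc \<Omega> f \<longleftrightarrow>
     (\<forall>i. (\<lambda>z. f z $ i) holomorphic_on ball 0 1) \<and> f ` ball 0 1 \<subseteq> \<Omega>"

definition kobayashi_metric :: "(complex ^ 'n) set \<Rightarrow> complex ^ 'n \<Rightarrow> complex ^ 'n \<Rightarrow> real" where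
  "kobayashi_metric \<Omega> z v =
     Inf {cmod \<zeta> | \<zeta> f. holomorphic_disc \<Omega> f \<and> f 0 = z \<and>
                      \<zeta> *s (\<chi> i. deriv (\<lambda>w. f w $ i) 0) = v}"

text \<open>The Poincare distance of the unit disc, normalised so that its infinitesimal form is
  \<open>|dz| / (1 - |z|\<^sup>2)\<close>. This is the normalisation for which the Kobayashi pseudodistance is the
  integrated form of \<open>kobayashi_metric\<close>.\<close>

definition poincare_dist :: "complex \<Rightarrow> complex \<Rightarrow> real" where
  "poincare_dist a b = artanh (cmod ((a - b) / (1 - cnj a * b)))"

text \<open>Infimum of the lengths of chains of analytic discs. On a domain there is always a chain
  between two points; the value 0 off \<open>\<Omega>\<close> is a dummy.\<close>

definition kobayashi_dist :: "(complex ^ 'n) set \<Rightarrow> complex ^ 'n \<Rightarrow> complex ^ 'n \<Rightarrow> real" where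
  "kobayashi_dist \<Omega> z w =
     (if z \<in> \<Omega> \<and> w \<in> \<Omega> then
        Inf {\<Sum>j<m. poincare_dist (a j) (b j) | m a b f p.
               m \<ge> 1 \<and> p 0 = z \<and> p m = w \<and>
               (\<forall>j<m. holomorphic_disc \<Omega> (f j) \<and> a j \<in> ball 0 1 \<and> b j \<in> ball 0 1 \<and>
                      f j (a j) = p j \<and> f j (b j) = p (Suc j))}
      else 0)"

text \<open>Cauchy-completeness of \<open>\<Omega>\<close> with respect to the Kobayashi distance, spelled out so that it
  does not presuppose that \<open>kobayashi_dist \<Omega>\<close> separates points (which it does for bounded \<open>\<Omega>\<close>).\<close>

definition kobayashi_complete :: "(complex ^ 'n) set \<Rightarrow> bool" where
  "kobayashi_complete \<Omega> \<longleftrightarrow>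
     (\<forall>x. range x \<subseteq> \<Omega> \<and>
          (\<forall>\<epsilon>>0. \<exists>N::nat. \<forall>m\<ge>N. \<forall>n\<ge>N. kobayashi_dist \<Omega> (x m) (x n) < \<epsilon>) \<longrightarrow>
          (\<exists>l\<in>\<Omega>. (\<lambda>n. kobayashi_dist \<Omega> (x n) l) \<longlonglongrightarrow> 0))"


section \<open>Almost-geodesics and visibility\<close>

text \<open>Members of a division are non-overlapping compact intervals, so this is the usual
  \<open>\<epsilon>\<close>-\<open>\<delta>\<close> definition of absolute continuity.\<close>

definition absolutely_continuous_curve :: "real set \<Rightarrow> (real \<Rightarrow> 'a::real_normed_vector) \<Rightarrow> bool" where
  "absolutely_continuous_curve I \<sigma> \<longleftrightarrow>
     (\<forall>\<epsilon>>0. \<exists>\<delta>>0. \<forall>\<D> S. \<D> division_of S \<and> S \<subseteq> I \<and> (\<Sum>J\<in>\<D>. Sup J - Inf J) < \<delta> \<longrightarrow>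
        (\<Sum>J\<in>\<D>. norm (\<sigma> (Sup J) - \<sigma> (Inf J))) < \<epsilon>)"

definition almost_geodesic ::
    "(complex ^ 'n) set \<Rightarrow> real \<Rightarrow> real \<Rightarrow> real set \<Rightarrow> (real \<Rightarrow> complex ^ 'n) \<Rightarrow> bool" where
  "almost_geodesic \<Omega> L \<kappa> I \<sigma> \<longleftrightarrow>
     is_interval I \<and> \<sigma> ` I \<subseteq> \<Omega> \<and>
     (\<forall>s\<in>I. \<forall>t\<in>I. \<bar>t - s\<bar> / L - \<kappa> \<le> kobayashi_dist \<Omega> (\<sigma> s) (\<sigma> t) \<and>
                   kobayashi_dist \<Omega> (\<sigma> s) (\<sigma> t) \<le> L * \<bar>t - s\<bar> + \<kappa>) \<and>
     absolutely_continuous_curve I \<sigma> \<and>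
     (AE t in lebesgue_on I.
        \<sigma> differentiable (at t within I) \<and>
        kobayashi_metric \<Omega> (\<sigma> t) (vector_derivative \<sigma> (at t within I)) \<le> L)"

definition visibility_domain :: "(complex ^ 'n) set \<Rightarrow> bool" where
  "visibility_domain \<Omega> \<longleftrightarrow>
     is_domain \<Omega> \<and> bounded \<Omega> \<and>
     (\<forall>L \<kappa> \<xi> \<eta> V W.
        L \<ge> 1 \<and> \<kappa> \<ge> 0 \<and> \<xi> \<in> frontier \<Omega> \<and> \<eta> \<in> frontier \<Omega> \<and> \<xi> \<noteq> \<eta> \<and>
        openin (top_of_set (closure \<Omega>)) V \<and> openin (top_of_set (closure \<Omega>)) W \<and>
        \<xi> \<in> V \<and> \<eta> \<in> W \<and> closure V \<inter> closure W = {} \<longrightarrow>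
        (\<exists>K. compact K \<and> K \<subseteq> \<Omega> \<and>
             (\<forall>\<sigma> a b. a \<le> b \<and> almost_geodesic \<Omega> L \<kappa> {a..b} \<sigma> \<and> \<sigma> a \<in> V \<and> \<sigma> b \<in> W \<longrightarrow>
                      \<sigma> ` {a..b} \<inter> K \<noteq> {})))"


section \<open>Pseudoconvexity\<close>

text \<open>For continuous \<open>u\<close>, plurisubharmonicity is the sub-mean value inequality over all closed
  affine discs in \<open>S\<close>; the radius of the disc is absorbed into \<open>w\<close>.\<close>

definition continuous_plurisubharmonic_on :: "(complex ^ 'n) set \<Rightarrow> (complex ^ 'n \<Rightarrow> real) \<Rightarrow> bool" where
  "continuous_plurisubharmonic_on S u \<longleftrightarrow>
     continuous_on S u \<and>
     (\<forall>z w. (\<lambda>\<zeta>. z + \<zeta> *s w) ` cball 0 1 \<subseteq> S \<longrightarrow>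
            u z \<le> 1 / (2 * pi) * integral {0..2 * pi} (\<lambda>\<theta>. u (z + cis \<theta> *s w)))"

definition pseudoconvex :: "(complex ^ 'n) set \<Rightarrow> bool" where
  "pseudoconvex S \<longleftrightarrow>
     open S \<and>
     (\<exists>u. continuous_plurisubharmonic_on S u \<and> (\<forall>c. compact {z \<in> S. u z \<le> c}))"

end

theory Submission
  imports Defs "HOL-Complex_Analysis.Riemann_Mapping"
begin

text \<open>A generic small perturbation of an analytic disc in \<open>D\<close> misses \<open>A\<close>, because \<open>A\<close> and the disc
  together have real dimension at most \<open>2 + 2 < 2n\<close>. Hence the Kobayashi metric and distance of
  \<open>\<Omega> = D - A\<close> are the restrictions of those of \<open>D\<close>, and every almost-geodesic of \<open>\<Omega>\<close> is one of \<open>D\<close>.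
  If almost-geodesics of \<open>\<Omega>\<close> with separated ends left every compact subset of \<open>\<Omega>\<close>, a subsequence
  would converge either to the boundary of \<open>D\<close>, against the visibility of \<open>D\<close>, or to \<open>A\<close>. In the
  latter case they are uniformly Lipschitz on bounded parameter intervals, and a limit is a
  nonconstant path in \<open>A\<close>; but a pseudo-arc contains no arc. A point of \<open>A\<close> is the limit of a
  Kobayashi-Cauchy sequence of \<open>\<Omega>\<close>, so \<open>\<Omega>\<close> is not complete, and discs touching \<open>A\<close> from outside at
  a point furthest from the origin violate the Kontinuitaetssatz.\<close>

section \<open>Generic perturbation of analytic discs\<close>

text \<open>A perturbation is useful only if it keeps the data that the Kobayashi quantities see:
  the values at two parameters for the distance, the value and the derivative at 0 for the metric.
  So a disc \<open>g\<close> is changed to \<open>g + q c\<close>, where a fixed polynomial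
  \<open>q\<close> vanishes at those parameters (doubly, for the derivative) and only the constant
  vector \<open>c\<close> is generic. At a zero of \<open>q\<close> nothing moves, so there the
  value must be off \<open>A\<close> beforehand. Two obstacles remain. A disc of \<open>D\<close>
  may approach the frontier of \<open>D\<close> and leave no room for any \<open>c\<close>; it is
  first restricted to a disc of radius \<open>r < 1\<close>, at a cost that vanishes as
  \<open>r\<close> tends to 1. And a joint of a chain of discs may lie in \<open>A\<close>; it must
  be moved, together with the ends of both discs that meet there. For the curves, compactness of
  \<open>A\<close> in \<open>D\<close> is decisive: thin neighbourhoods of \<open>A\<close> and of
  the frontier of \<open>D\<close> are disjoint, so a connected curve that misses a large compact
  subset of \<open>D - A\<close> lies in one of them.\<close>

lemma norm_smult_complex_vec: "norm (c *s v) = cmod c * norm v" for v :: "complex ^ 'n"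
  by (simp add: norm_vec_def norm_mult L2_set_right_distrib)

text \<open>Only increments from the fixed point \<open>x\<close> are controlled. This is the local
  hypothesis of \<open>negligible_locally_Lipschitz_image\<close>, and convergence of the difference
  quotient at \<open>x\<close> yields it directly.\<close>

lemma has_field_derivative_pointwise_lipschitz:
  fixes f :: "'a::real_normed_field \<Rightarrow> 'a"
  assumes "(f has_field_derivative D) (at x)"
  shows "\<exists>B\<ge>0. eventually (\<lambda>y. norm (f y - f x) \<le> B * norm (y - x)) (nhds x)"
proof -
  have "((\<lambda>y. norm ((f y - f x) / (y - x))) \<longlongrightarrow> norm D) (at x)"
    using assms by (intro tendsto_norm) (simp add: has_field_derivative_iff)
  then have "eventually (\<lambda>y. norm ((f y - f x) / (y - x)) < norm D + 1) (at x)"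
    by (rule order_tendstoD) simp
  then have "eventually (\<lambda>y. y \<noteq> x \<longrightarrow> norm ((f y - f x) / (y - x)) < norm D + 1) (nhds x)"
    by (simp add: eventually_at_filter)
  then have "eventually (\<lambda>y. norm (f y - f x) \<le> (norm D + 1) * norm (y - x)) (nhds x)"
    by eventually_elim (force simp: norm_divide divide_simps split: if_splits)
  then show ?thesis
    by (intro exI[of _ "norm D + 1"]) auto
qed

lemma holomorphic_pointwise_lipschitz:
  fixes f :: "complex \<Rightarrow> complex"
  assumes "f holomorphic_on S" "open S" "x \<in> S"
  shows "\<exists>B\<ge>0. eventually (\<lambda>y. norm (f y - f x) \<le> B * norm (y - x)) (nhds x)"
  using has_field_derivative_pointwise_lipschitz holomorphic_derivI[OF assms] by blast

lemma holomorphic_vec_pointwise_lipschitz: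
  fixes f :: "complex \<Rightarrow> complex ^ 'n"
  assumes "\<And>i. (\<lambda>z. f z $ i) holomorphic_on S" "open S" "x \<in> S"
  shows "\<exists>B\<ge>0. eventually (\<lambda>y. norm (f y - f x) \<le> B * norm (y - x)) (nhds x)"
proof -
  have "\<forall>i. \<exists>B\<ge>0. eventually (\<lambda>y. norm (f y $ i - f x $ i) \<le> B * norm (y - x)) (nhds x)"
    using holomorphic_pointwise_lipschitz[OF assms(1) assms(2,3)] by blast
  then obtain B where B: "\<And>i. B i \<ge> 0"
      "\<And>i. eventually (\<lambda>y. norm (f y $ i - f x $ i) \<le> B i * norm (y - x)) (nhds x)"
    by metis
  have "eventually (\<lambda>y. \<forall>i. norm (f y $ i - f x $ i) \<le> B i * norm (y - x)) (nhds x)"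
    by (intro eventually_all_finite B)
  then have "eventually (\<lambda>y. norm (f y - f x) \<le> (\<Sum>i\<in>UNIV. B i) * norm (y - x)) (nhds x)"
  proof eventually_elim
    case (elim y)
    have "norm (f y - f x) \<le> (\<Sum>i\<in>UNIV. norm ((f y - f x) $ i))"
      unfolding norm_vec_def by (rule L2_set_le_sum) auto
    also have "\<dots> \<le> (\<Sum>i\<in>UNIV. B i * norm (y - x))"
      using elim by (intro sum_mono) auto
    finally show ?case by (simp add: sum_distrib_right)
  qed
  moreover have "(\<Sum>i\<in>UNIV. B i) \<ge> 0" by (intro sum_nonneg B)
  ultimately show ?thesis by blast
qed

lemma holomorphic_vec_continuous_on:
  fixes f :: "complex \<Rightarrow> complex ^ 'n"
  assumes "\<And>i. (\<lambda>z. f z $ i) holomorphic_on S"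
  shows "continuous_on S f"
proof -
  have "continuous_on S (\<lambda>z. \<chi> i. f z $ i)"
    by (intro continuous_on_vec_lambda holomorphic_on_imp_continuous_on assms)
  then show ?thesis by simp
qed

text \<open>The values \<open>c\<close> for which \<open>g + q c\<close> meets \<open>\<psi> ` P\<close> form the image of a subset of
  \<open>\<real>\<^sup>2 \<times> \<complex>\<close>, of dimension 4, under the locally Lipschitz map \<open>(p, z) \<mapsto> (\<psi> p - g z) / q z\<close>
  into a space of dimension at least 6. The real factor below makes the set null already in
  the source.\<close>

lemma perturbation_avoiding:
  fixes g :: "complex \<Rightarrow> complex ^ 'n" and \<psi> :: "real ^ 2 \<Rightarrow> complex ^ 'n"
  assumes card: "CARD('n) \<ge> 3" and lip: "L-lipschitz_on P \<psi>"
    and g: "\<And>i. (\<lambda>z. g z $ i) holomorphic_on ball 0 1"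
    and q: "q holomorphic_on ball 0 1" and "e > 0"
    and zeros: "\<And>z. z \<in> ball 0 1 \<Longrightarrow> q z = 0 \<Longrightarrow> g z \<notin> \<psi> ` P"
  obtains c where "norm c < e" "\<And>z. z \<in> ball 0 1 \<Longrightarrow> g z + q z *s c \<notin> \<psi> ` P"
proof -
  define Z where "Z = {z \<in> ball 0 1. q z \<noteq> 0}"
  define S where "S = P \<times> Z \<times> {0::real}"
  define F where "F = (\<lambda>(p, z, t::real). inverse (q z) *s (\<psi> p - g z))"
  have "open (ball 0 1 \<inter> q -` (- {0}))"
    by (intro continuous_open_preimage holomorphic_on_imp_continuous_on q) auto
  then have "open Z"
    by (rule back_subst[where P="open"]) (auto simp: Z_def)
  have "negligible (F ` S)"
  proof (rule negligible_locally_Lipschitz_image)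
    show "DIM((real^2) \<times> complex \<times> real) \<le> DIM(complex ^ 'n)"
      using card by simp
    have "negligible {x :: (real^2) \<times> complex \<times> real. (0, 0, 1) \<bullet> x = 0}"
      by (rule negligible_hyperplane) (simp add: prod_eq_iff)
    then show "negligible S"
      by (rule negligible_subset) (auto simp: S_def)
    fix x assume "x \<in> S"
    then obtain p0 z0 where x: "x = (p0, z0, 0)" "p0 \<in> P" "z0 \<in> Z"
      by (auto simp: S_def)
    have hq: "(\<lambda>z. inverse (q z)) holomorphic_on Z"
      by (intro holomorphic_intros holomorphic_on_subset[OF q]) (auto simp: Z_def)
    obtain B1 where B1: "B1 \<ge> 0"
        "eventually (\<lambda>z. norm (inverse (q z) - inverse (q z0)) \<le> B1 * norm (z - z0)) (nhds z0)"
      using holomorphic_pointwise_lipschitz[OF hq \<open>open Z\<close> x(3)] by auto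
    have gZ: "(\<lambda>z. g z $ i) holomorphic_on Z" for i
      by (rule holomorphic_on_subset[OF g]) (auto simp: Z_def)
    then obtain B2 where B2: "B2 \<ge> 0"
        "eventually (\<lambda>z. norm (g z - g z0) \<le> B2 * norm (z - z0)) (nhds z0)"
      using holomorphic_vec_pointwise_lipschitz[OF gZ \<open>open Z\<close> x(3)] by auto
    \<comment> \<open>Staying within distance 1 of \<open>z0\<close> turns the Lipschitz estimate
      for \<open>inverse (q z)\<close> into the bound \<open>cmod (inverse (q z0)) + B1\<close>,
      used in \<open>iq\<close>.\<close>
    have "eventually (\<lambda>z. norm (z - z0) < 1) (nhds z0)"
      using eventually_nhds_ball[of 1 z0] by (simp add: dist_commute dist_norm norm_minus_commute)
    with B1(2) B2(2) have "eventually (\<lambda>z. norm (inverse (q z) - inverse (q z0)) \<le> B1 * norm (z - z0)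
        \<and> norm (g z - g z0) \<le> B2 * norm (z - z0) \<and> norm (z - z0) < 1) (nhds z0)"
      by (simp add: eventually_conj_iff)
    then obtain T where T: "open T" "z0 \<in> T" "\<And>z. z \<in> T \<Longrightarrow>
        norm (inverse (q z) - inverse (q z0)) \<le> B1 * norm (z - z0)
        \<and> norm (g z - g z0) \<le> B2 * norm (z - z0) \<and> norm (z - z0) < 1"
      unfolding eventually_nhds by blast
    define N where "N = norm (\<psi> p0 - g z0)"
    define B where "B = (cmod (inverse (q z0)) + B1) * (L + B2) + B1 * N"
    have L: "L \<ge> 0" using lip by (rule lipschitz_on_nonneg)
    have "norm (F y - F x) \<le> B * norm (y - x)" if y: "y \<in> S \<inter> (UNIV \<times> T \<times> UNIV)" for y
    proof -
      obtain p z where yy: "y = (p, z, 0)" "p \<in> P" "z \<in> Z" "z \<in> T"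
        using y by (auto simp: S_def)
      have yx: "y - x = (p - p0, z - z0, 0)" by (simp add: x yy)
      have n1: "norm (p - p0) \<le> norm (y - x)"
        unfolding yx by (rule norm_fst_le)
      have n2: "norm (z - z0) \<le> norm (y - x)"
        unfolding yx by (rule order_trans[OF norm_fst_le norm_snd_le])
      have iq: "cmod (inverse (q z)) \<le> cmod (inverse (q z0)) + B1"
      proof -
        have "cmod (inverse (q z)) \<le> cmod (inverse (q z0)) + cmod (inverse (q z) - inverse (q z0))"
          using norm_triangle_ineq[of "inverse (q z0)" "inverse (q z) - inverse (q z0)"] by simp
        also have "\<dots> \<le> cmod (inverse (q z0)) + B1 * norm (z - z0)"
          using T(3)[OF yy(4)] by simp
        also have "B1 * norm (z - z0) \<le> B1"
          using T(3)[OF yy(4)] B1(1) by (simp add: mult_left_le)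
        finally show ?thesis by simp
      qed
      have 1: "norm (\<psi> p - \<psi> p0) \<le> L * norm (y - x)"
        using lipschitz_onD[OF lip yy(2) x(2)] mult_left_mono[OF n1 L] by (simp add: dist_norm)
      have 2: "norm (g z - g z0) \<le> B2 * norm (y - x)"
        using T(3)[OF yy(4)] mult_left_mono[OF n2 B2(1)] by simp
      have 3: "norm (inverse (q z) - inverse (q z0)) \<le> B1 * norm (y - x)"
        using T(3)[OF yy(4)] mult_left_mono[OF n2 B1(1)] by simp
      \<comment> \<open>Product rule for increments: the first factor is bounded near
        \<open>z0\<close>, the second vector \<open>\<psi> p0 - g z0\<close> is constant with norm
        \<open>N\<close>. This explains the shape of \<open>B\<close>.\<close>
      have "F y - F x = inverse (q z) *s ((\<psi> p - \<psi> p0) - (g z - g z0))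
          + (inverse (q z) - inverse (q z0)) *s (\<psi> p0 - g z0)"
        by (simp add: F_def x yy vec_eq_iff algebra_simps)
      then have "norm (F y - F x) \<le> cmod (inverse (q z)) * norm ((\<psi> p - \<psi> p0) - (g z - g z0))
          + cmod (inverse (q z) - inverse (q z0)) * N"
        using norm_triangle_ineq unfolding N_def norm_smult_complex_vec[symmetric] by metis
      also have "\<dots> \<le> (cmod (inverse (q z0)) + B1) * (L * norm (y - x) + B2 * norm (y - x))
          + (B1 * norm (y - x)) * N"
        using B1(1) by (intro add_mono mult_mono iq 3 order_trans[OF norm_triangle_ineq4 add_mono[OF 1 2]])
          (auto simp: N_def)
      also have "\<dots> = B * norm (y - x)"
        by (simp add: B_def algebra_simps)
      finally show ?thesis .
    qed
    moreover have "open (UNIV \<times> T \<times> (UNIV :: real set))"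
      by (intro open_Times T) auto
    ultimately show "\<exists>T B. open T \<and> x \<in> T \<and> (\<forall>y\<in>S \<inter> T. norm (F y - F x) \<le> B * norm (y - x))"
      using T(2) by (intro exI[of _ "UNIV \<times> T \<times> UNIV"] exI[of _ B]) (auto simp: x)
  qed
  moreover have "\<not> negligible (ball (0 :: complex ^ 'n) e)"
    using \<open>e > 0\<close> by (intro open_not_negligible) auto
  ultimately obtain c where c: "c \<in> ball 0 e" "c \<notin> F ` S"
    using negligible_subset by blast
  show ?thesis
  proof
    show "norm c < e" using c by simp
    fix z :: complex assume z: "z \<in> ball 0 1"
    show "g z + q z *s c \<notin> \<psi> ` P"
    proof
      assume "g z + q z *s c \<in> \<psi> ` P"
      then obtain p where p: "p \<in> P" "g z + q z *s c = \<psi> p" by auto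
      \<comment> \<open>At a zero of \<open>q\<close> the perturbed value is \<open>g z\<close>,
        which \<open>zeros\<close> keeps off the set. Elsewhere the equation can be solved for
        \<open>c\<close>, which would put \<open>c\<close> into the null image.\<close>
      have "q z \<noteq> 0"
        using zeros[OF z] p by force
      then have "c = F (p, z, 0)"
        by (simp add: F_def vec_eq_iff flip: p(2))
      moreover have "(p, z, 0) \<in> S" using p z \<open>q z \<noteq> 0\<close> by (auto simp: S_def Z_def)
      ultimately show False using c by blast
    qed
  qed
qed

section \<open>The Poincare distance of the unit disc\<close>

lemma poincare_dist_less_1:
  assumes "a \<in> ball 0 1" "b \<in> ball 0 1"
  shows "cmod ((a - b) / (1 - cnj a * b)) < 1"
  using Moebius_function_norm_lt_1[of a b 0] assms
  by (simp add: Moebius_function_simple norm_divide norm_minus_commute)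

lemma le_artanh:
  assumes "0 \<le> x" "x < (1::real)"
  shows "x \<le> artanh x"
proof (cases "x = 0")
  case False
  then have "x > 0" using assms by simp
  have "\<exists>z. z > 0 \<and> z < x \<and> artanh x - artanh 0 = (x - 0) * (1 / (1 - z\<^sup>2))"
    using \<open>x > 0\<close> assms by (intro MVT2 artanh_real_has_field_derivative) auto
  then obtain z where z: "z > 0" "z < x" "artanh x = x * (1 / (1 - z\<^sup>2))" by auto
  have "0 < z\<^sup>2" "z\<^sup>2 < 1" using z assms by (auto simp: power_less_one_iff abs_square_less_1)
  then have "1 \<le> 1 / (1 - z\<^sup>2)" by (simp add: field_simps)
  then show ?thesis using \<open>x > 0\<close> z(3) by (metis mult.right_neutral mult_left_mono less_imp_le)
qed simp

lemma poincare_dist_ge: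
  assumes "a \<in> ball 0 1" "b \<in> ball 0 1"
  shows "cmod ((a - b) / (1 - cnj a * b)) \<le> poincare_dist a b"
  unfolding poincare_dist_def using poincare_dist_less_1[OF assms] by (intro le_artanh) auto

lemma poincare_dist_nonneg:
  assumes "a \<in> ball 0 1" "b \<in> ball 0 1"
  shows "0 \<le> poincare_dist a b"
  using poincare_dist_ge[OF assms] norm_ge_zero order_trans by blast

lemma poincare_dist_0_of_real: "0 \<le> t \<Longrightarrow> poincare_dist 0 (of_real t) = artanh t"
    "0 \<le> t \<Longrightarrow> poincare_dist (of_real t) 0 = artanh t"
  by (simp_all add: poincare_dist_def)

lemma tendsto_poincare_dist:
  assumes "a \<in> ball 0 1" "b \<in> ball 0 1" "(f \<longlongrightarrow> a) F" "(g \<longlongrightarrow> b) F"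
  shows "((\<lambda>x. poincare_dist (f x) (g x)) \<longlongrightarrow> poincare_dist a b) F"
proof -
  have "cmod (cnj a * b) < 1"
    using assms norm_mult_less[of "cnj a" 1 b 1] by auto
  then have "1 - cnj a * b \<noteq> 0" by auto
  then have "((\<lambda>x. cmod ((f x - g x) / (1 - cnj (f x) * g x))) \<longlongrightarrow> cmod ((a - b) / (1 - cnj a * b))) F"
    by (intro tendsto_intros assms)
  moreover have "isCont artanh (cmod ((a - b) / (1 - cnj a * b)))"
    using poincare_dist_less_1[OF assms(1,2)]
    by (intro DERIV_isCont[OF artanh_real_has_field_derivative]) simp
  ultimately show ?thesis
    unfolding poincare_dist_def by (rule isCont_tendsto_compose[rotated])
qed

text \<open>This isolates what the dimension count gives, so that the arguments about discs never
  mention \<open>\<psi>\<close> or \<open>P\<close>. One constant vector \<open>c\<close>, as small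
  as desired, serves the whole disc at once.\<close>

definition avoidable :: "(complex ^ 'n) set \<Rightarrow> bool" where
  "avoidable A \<longleftrightarrow>
     (\<forall>g q e. (\<forall>i. (\<lambda>z. g z $ i) holomorphic_on ball 0 1) \<and> q holomorphic_on ball 0 1 \<and> e > 0 \<and>
        (\<forall>z\<in>ball 0 1. q z = 0 \<longrightarrow> g z \<notin> A) \<longrightarrow>
        (\<exists>c. norm c < e \<and> (\<forall>z\<in>ball 0 1. g z + q z *s c \<notin> A)))"

lemma avoidable_lipschitz_image:
  fixes \<psi> :: "real ^ 2 \<Rightarrow> complex ^ 'n"
  assumes "CARD('n) \<ge> 3" "L-lipschitz_on P \<psi>"
  shows "avoidable (\<psi> ` P)"
  unfolding avoidable_def
proof (intro allI impI, elim conjE)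
  fix g :: "complex \<Rightarrow> complex ^ 'n" and q :: "complex \<Rightarrow> complex" and e :: real
  assume "\<forall>i. (\<lambda>z. g z $ i) holomorphic_on ball 0 1" "q holomorphic_on ball 0 1" "e > 0"
    "\<forall>z\<in>ball 0 1. q z = 0 \<longrightarrow> g z \<notin> \<psi> ` P"
  then show "\<exists>c. norm c < e \<and> (\<forall>z\<in>ball 0 1. g z + q z *s c \<notin> \<psi> ` P)"
    by (metis perturbation_avoiding[OF assms, of g q e])
qed

text \<open>A constant disc with \<open>q = 1\<close> has no zeros to respect, so its generic
  translate leaves \<open>A\<close>. Thus \<open>A\<close> has dense complement.\<close>

lemma avoidable_point_near:
  fixes u :: "complex ^ 'n"
  assumes "avoidable A" "e > 0"
  obtains u' where "norm (u' - u) < e" "u' \<notin> A"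
proof -
  have "\<exists>c. norm c < e \<and> (\<forall>z\<in>ball (0::complex) 1. u + 1 *s c \<notin> A)"
    using assms unfolding avoidable_def by (elim allE[of _ "\<lambda>_. u"] allE[of _ "\<lambda>_. 1"] allE[of _ e]) auto
  then obtain c where c: "norm c < e" "\<forall>z\<in>ball (0::complex) 1. u + 1 *s c \<notin> A" by blast
  show ?thesis
    using bspec[OF c(2), of 0] c(1) by (intro that[of "u + c"]) auto
qed

lemma avoidable_disc:
  fixes g :: "complex \<Rightarrow> complex ^ 'n"
  assumes av: "avoidable A" and g: "\<And>i. (\<lambda>z. g z $ i) holomorphic_on ball 0 1"
    and q: "q holomorphic_on ball 0 1" and M: "\<And>z. z \<in> ball 0 1 \<Longrightarrow> cmod (q z) \<le> M"
    and "\<eta> > 0" and room: "\<And>z y. z \<in> ball 0 1 \<Longrightarrow> norm y < \<eta> \<Longrightarrow> g z + y \<in> D"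
    and zeros: "\<And>z. z \<in> ball 0 1 \<Longrightarrow> q z = 0 \<Longrightarrow> g z \<notin> A"
  obtains c where "holomorphic_disc (D - A) (\<lambda>z. g z + q z *s c)"
proof -
  have "M \<ge> 0" using M[of 0] order_trans[OF norm_ge_zero] by force
  \<comment> \<open>If \<open>norm c < e\<close>, then \<open>q z *s c\<close> has norm below
    \<open>\<eta>\<close> on the whole disc; the added 1 keeps the divisor positive when
    \<open>M = 0\<close>.\<close>
  define e where "e = \<eta> / (M + 1)"
  have "e > 0" using \<open>M \<ge> 0\<close> \<open>\<eta> > 0\<close> by (simp add: e_def)
  have "\<exists>c. norm c < e \<and> (\<forall>z\<in>ball 0 1. g z + q z *s c \<notin> A)"
    using av[unfolded avoidable_def, rule_format, of g q e] g q zeros \<open>e > 0\<close> by blast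
  then obtain c where c: "norm c < e" "\<And>z. z \<in> ball 0 1 \<Longrightarrow> g z + q z *s c \<notin> A" by blast
  have "g z + q z *s c \<in> D" if "z \<in> ball 0 1" for z
  proof (rule room[OF that])
    have "norm (q z *s c) \<le> M * norm c"
      using M[OF that] by (simp add: norm_smult_complex_vec mult_right_mono)
    also have "\<dots> \<le> (M + 1) * norm c" by (simp add: algebra_simps)
    also have "\<dots> < (M + 1) * e" using c \<open>M \<ge> 0\<close> by (intro mult_strict_left_mono) auto
    also have "\<dots> = \<eta>" using \<open>M \<ge> 0\<close> by (simp add: e_def)
    finally show "norm (q z *s c) < \<eta>" .
  qed
  then show ?thesis using c(2)
    by (intro that[of c]) (auto simp: holomorphic_disc_def intro!: holomorphic_intros g q)
qed

lemma holomorphic_on_shrunk: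
  fixes f :: "complex \<Rightarrow> complex"
  assumes "f holomorphic_on ball 0 1" "0 < r" "r < 1"
  shows "(\<lambda>z. f (of_real r * z)) holomorphic_on ball 0 1"
proof -
  have "(f \<circ> (\<lambda>z. of_real r * z)) holomorphic_on ball 0 1"
  proof (rule holomorphic_on_compose_gen)
    show "(\<lambda>z. complex_of_real r * z) ` ball 0 1 \<subseteq> ball 0 1"
      using assms by (auto simp: norm_mult intro!: le_less_trans[OF mult_left_le_one_le])
  qed (use assms in \<open>auto intro!: holomorphic_intros\<close>)
  then show ?thesis by (simp add: o_def)
qed

text \<open>The image of \<open>cball 0 r\<close> is compact in the open set \<open>D\<close>, so a
  single \<open>\<eta>\<close> works for every point of the shrunk disc.\<close>

lemma shrunk_disc_room:
  fixes f :: "complex \<Rightarrow> complex ^ 'n"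
  assumes "holomorphic_disc D f" "open D" "0 < r" "r < 1"
  obtains \<eta> where "\<eta> > 0" "\<And>z y. z \<in> ball 0 1 \<Longrightarrow> norm y < \<eta> \<Longrightarrow> f (of_real r * z) + y \<in> D"
proof -
  have sub: "cball 0 r \<subseteq> ball (0::complex) 1" using assms by auto
  have "continuous_on (cball 0 r) f"
    using assms(1) by (intro continuous_on_subset[OF holomorphic_vec_continuous_on sub])
      (auto simp: holomorphic_disc_def)
  then have "compact (f ` cball 0 r)"
    by (intro compact_continuous_image) auto
  moreover have "f ` cball 0 r \<subseteq> D"
    using assms(1) sub by (auto simp: holomorphic_disc_def)
  ultimately obtain \<eta> where \<eta>: "\<eta> > 0" "(\<Union>x\<in>f ` cball 0 r. ball x \<eta>) \<subseteq> D"
    using compact_subset_open_imp_ball_epsilon_subset \<open>open D\<close> by metis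
  show ?thesis
  proof (rule that[OF \<eta>(1)])
    fix z :: complex and y :: "complex ^ 'n" assume zy: "z \<in> ball 0 1" "norm y < \<eta>"
    have "of_real r * z \<in> cball 0 r"
      using zy assms by (auto simp: norm_mult mult_le_cancel_left1 intro: less_imp_le)
    moreover have "f (of_real r * z) + y \<in> ball (f (of_real r * z)) \<eta>"
      using zy by (simp add: dist_norm)
    ultimately show "f (of_real r * z) + y \<in> D" using \<eta>(2) by blast
  qed
qed

text \<open>Three corrections are made to \<open>f\<close>. Shrinking moves the parameters to
  \<open>a / r\<close> and \<open>b / r\<close>, whose Poincare distance tends to that of
  \<open>a\<close> and \<open>b\<close> as \<open>r\<close> tends to 1. An affine term makes the end
  values exactly \<open>z\<close> and \<open>w\<close>. A generic multiple of a quadratic vanishing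
  at both parameters then removes \<open>A\<close>.\<close>

lemma perturbed_disc_through_distinct:
  fixes f :: "complex \<Rightarrow> complex ^ 'n"
  assumes av: "avoidable A" and D: "open D" "holomorphic_disc D f"
    and ab: "a \<in> ball 0 1" "b \<in> ball 0 1" "a \<noteq> b" and "e > 0"
  shows "\<exists>d>0. \<forall>z w. z \<notin> A \<and> w \<notin> A \<and> norm (z - f a) < d \<and> norm (w - f b) < d \<longrightarrow>
    (\<exists>g a' b'. holomorphic_disc (D - A) g \<and> a' \<in> ball 0 1 \<and> b' \<in> ball 0 1 \<and> g a' = z \<and> g b' = w \<and>
       poincare_dist a' b' < poincare_dist a b + e)"
proof -
  have lim: "((\<lambda>r. c / of_real r) \<longlongrightarrow> c) (at_left 1)" for c :: complex
    using tendsto_divide[OF tendsto_const tendsto_of_real[OF tendsto_ident_at], of "1::real" c] by simp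
  have "eventually (\<lambda>r. poincare_dist (a / of_real r) (b / of_real r) < poincare_dist a b + e) (at_left 1)"
    using \<open>e > 0\<close> by (intro order_tendstoD(2)[OF tendsto_poincare_dist[OF ab(1,2) lim lim]]) auto
  moreover have "eventually (\<lambda>r::real. r > max (cmod a) (cmod b)) (at_left 1)"
    using ab by (intro order_tendstoD(1)[OF tendsto_ident_at]) auto
  moreover have "eventually (\<lambda>r::real. r < 1) (at_left 1)"
    by (auto simp: eventually_at_filter)
  ultimately have "eventually (\<lambda>r. poincare_dist (a / of_real r) (b / of_real r) < poincare_dist a b + e
      \<and> r > max (cmod a) (cmod b) \<and> r < 1) (at_left 1)"
    by (intro eventually_conj)
  then obtain r where r: "poincare_dist (a / of_real r) (b / of_real r) < poincare_dist a b + e"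
      "r > cmod a" "r > cmod b" "r < 1"
    using eventually_happens'[OF trivial_limit_at_left_real] by (metis (mono_tags, lifting) max_less_iff_conj)
  have "r > 0" using r(2) norm_ge_zero le_less_trans by blast
  define a' b' where "a' = a / of_real r" and "b' = b / of_real r"
  have ab': "a' \<in> ball 0 1" "b' \<in> ball 0 1" "a' \<noteq> b'" "of_real r * a' = a" "of_real r * b' = b"
    using r \<open>r > 0\<close> ab by (auto simp: a'_def b'_def norm_divide)
  obtain \<eta> where \<eta>: "\<eta> > 0" "\<And>z y. z \<in> ball 0 1 \<Longrightarrow> norm y < \<eta> \<Longrightarrow> f (of_real r * z) + y \<in> D"
    using shrunk_disc_room[OF D(2,1) \<open>r > 0\<close> r(4)] by metis
  \<comment> \<open>On the unit disc each linear factor has modulus at most 2, so each of the two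
    terms of \<open>h\<close> costs at most \<open>\<eta> / 4\<close>. Half of the room is left for
    the generic term.\<close>
  define d where "d = \<eta> * cmod (a' - b') / 8"
  have "d > 0" using \<eta>(1) ab'(3) by (simp add: d_def)
  have "\<exists>g a' b'. holomorphic_disc (D - A) g \<and> a' \<in> ball 0 1 \<and> b' \<in> ball 0 1 \<and> g a' = z \<and> g b' = w \<and>
       poincare_dist a' b' < poincare_dist a b + e"
    if zw: "z \<notin> A" "w \<notin> A" "norm (z - f a) < d" "norm (w - f b) < d" for z w
  proof -
    \<comment> \<open>Lagrange interpolation of the required end corrections at \<open>a'\<close>
      and \<open>b'\<close>.\<close>
    define h where "h = (\<lambda>x. ((x - b') / (a' - b')) *s (z - f a) + ((x - a') / (b' - a')) *s (w - f b))"
    define g where "g = (\<lambda>x. f (of_real r * x) + h x)"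
    define q where "q = (\<lambda>x. (x - a') * (x - b'))"
    have g1: "g a' = z" "g b' = w"
      using ab' by (auto simp: g_def h_def)
    have h_bound: "norm (h x) < \<eta> / 2" if x: "x \<in> ball 0 1" for x
    proof -
      have *: "norm (((x - p) / t) *s v) \<le> 2 / cmod (a' - b') * d"
        if "norm p < 1" "norm v < d" "cmod t = cmod (a' - b')" for p t and v :: "complex ^ 'n"
      proof -
        have "cmod (x - p) \<le> 2"
          using norm_triangle_ineq4[of x p] x that(1) by auto
        then have "cmod (x - p) / cmod t \<le> 2 / cmod (a' - b')"
          unfolding that(3) by (intro divide_right_mono) auto
        then show ?thesis using that(2)
          unfolding norm_smult_complex_vec norm_divide by (intro mult_mono) auto
      qed
      \<comment> \<open>The estimate of \<open>*\<close> with a strict sign; one strict summand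
        makes the bound on \<open>h x\<close> strict.\<close>
      have "norm (((x - b') / (a' - b')) *s (z - f a)) < 2 / cmod (a' - b') * d"
      proof -
        have "cmod (x - b') \<le> 2"
          using norm_triangle_ineq4[of x b'] x ab'(2) by auto
        then have "cmod (x - b') / cmod (a' - b') * norm (z - f a) \<le> 2 / cmod (a' - b') * norm (z - f a)"
          using ab'(3) by (intro mult_right_mono divide_right_mono) auto
        also have "\<dots> < 2 / cmod (a' - b') * d"
          using ab'(3) zw(3) by (intro mult_strict_left_mono) auto
        finally show ?thesis unfolding norm_smult_complex_vec norm_divide .
      qed
      moreover have "norm (((x - a') / (b' - a')) *s (w - f b)) \<le> 2 / cmod (a' - b') * d"
        using ab' zw by (intro *) (auto simp: norm_minus_commute)
      ultimately have "norm (h x) < 2 / cmod (a' - b') * d + 2 / cmod (a' - b') * d"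
        unfolding h_def by (intro le_less_trans[OF norm_triangle_ineq] add_less_le_mono)
      also have "\<dots> = \<eta> / 2" using ab'(3) by (simp add: d_def)
      finally show ?thesis .
    qed
    obtain c where c: "holomorphic_disc (D - A) (\<lambda>x. g x + q x *s c)"
    proof (rule avoidable_disc[OF av])
      fix i
      have "(\<lambda>x. f x $ i) holomorphic_on ball 0 1"
        using D(2) by (auto simp: holomorphic_disc_def)
      note * = holomorphic_on_shrunk[OF this \<open>r > 0\<close> r(4)]
      show "(\<lambda>x. g x $ i) holomorphic_on ball 0 1"
        using ab'(3) unfolding g_def h_def by (auto intro!: holomorphic_intros *)
    next
      show "q holomorphic_on ball 0 1"
        unfolding q_def by (intro holomorphic_intros)
    next
      fix x :: complex assume x: "x \<in> ball 0 1"
      have "cmod (x - a') \<le> 2" "cmod (x - b') \<le> 2"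
        using norm_triangle_ineq4[of x a'] norm_triangle_ineq4[of x b'] x ab' by auto
      then show "cmod (q x) \<le> 2 * 2"
        unfolding q_def norm_mult by (intro mult_mono) auto
    next
      show "\<eta> / 2 > 0" using \<eta> by simp
    next
      fix x :: complex and y :: "complex ^ 'n" assume x: "x \<in> ball 0 1" "norm y < \<eta> / 2"
      have "norm (h x + y) < \<eta>"
        using norm_triangle_ineq[of "h x" y] h_bound[OF x(1)] x(2) by linarith
      then show "g x + y \<in> D"
        using \<eta>(2)[OF x(1), of "h x + y"] by (simp add: g_def add.assoc)
    next
      fix x assume "q x = 0"
      then have "x = a' \<or> x = b'" by (auto simp: q_def)
      then show "g x \<notin> A" using g1 zw by auto
    qed
    then have "holomorphic_disc (D - A) (\<lambda>x. g x + q x *s c)" by blast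
    moreover have "g a' + q a' *s c = z" "g b' + q b' *s c = w"
      using g1 by (auto simp: q_def)
    ultimately show ?thesis using ab' r(1) unfolding a'_def[symmetric] b'_def[symmetric] by blast
  qed
  then show ?thesis using \<open>d > 0\<close> by blast
qed

text \<open>If \<open>a = b\<close>, two different targets \<open>z\<close> and \<open>w\<close>
  cannot be reached from one parameter. The constant disc at \<open>f a\<close> is then used with
  parameters 0 and a small nonzero \<open>t\<close>, which costs less than \<open>e / 2\<close> and
  falls under the distinct case.\<close>

lemma perturbed_disc_through:
  assumes av: "avoidable A" and D: "open D" "holomorphic_disc D f"
    and ab: "a \<in> ball 0 1" "b \<in> ball 0 1" and "e > 0"
  shows "\<exists>d>0. \<forall>z w. z \<notin> A \<and> w \<notin> A \<and> norm (z - f a) < d \<and> norm (w - f b) < d \<longrightarrow>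
    (\<exists>g a' b'. holomorphic_disc (D - A) g \<and> a' \<in> ball 0 1 \<and> b' \<in> ball 0 1 \<and> g a' = z \<and> g b' = w \<and>
       poincare_dist a' b' < poincare_dist a b + e)"
proof (cases "a = b")
  case False
  then show ?thesis using perturbed_disc_through_distinct assms by blast
next
  case True
  have fa: "f a \<in> D" using D ab by (auto simp: holomorphic_disc_def)
  have const: "holomorphic_disc D (\<lambda>_. f a)"
    using fa by (auto simp: holomorphic_disc_def)
  have "((\<lambda>t. poincare_dist 0 t) \<longlongrightarrow> poincare_dist 0 0) (at (0::complex))"
    by (intro tendsto_poincare_dist tendsto_intros) auto
  then have "eventually (\<lambda>t::complex. poincare_dist 0 t < e / 2) (at 0)"
    using \<open>e > 0\<close> by (intro order_tendstoD(2)) (auto simp: poincare_dist_def)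
  moreover have "eventually (\<lambda>t::complex. t \<in> ball 0 1 - {0}) (at 0)"
    by (auto simp: eventually_at intro!: exI[of _ 1])
  ultimately have "eventually (\<lambda>t::complex. poincare_dist 0 t < e / 2 \<and> t \<in> ball 0 1 - {0}) (at 0)"
    by (rule eventually_conj)
  then obtain t :: complex where t: "poincare_dist 0 t < e / 2" "t \<in> ball 0 1" "t \<noteq> 0"
    using eventually_happens'[OF trivial_limit_at] by (metis (mono_tags, lifting) Diff_iff singletonI)
  have "poincare_dist 0 t + e / 2 < poincare_dist a b + e"
    using t poincare_dist_nonneg[OF ab] by linarith
  then have *: "x < poincare_dist a b + e" if "x < poincare_dist 0 t + e / 2" for x
    using that by linarith
  obtain d where "d > 0" and d: "\<And>z w. z \<notin> A \<Longrightarrow> w \<notin> A \<Longrightarrow> norm (z - f a) < d \<Longrightarrow> norm (w - f a) < d \<Longrightarrow>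
    \<exists>g a' b'. holomorphic_disc (D - A) g \<and> a' \<in> ball 0 1 \<and> b' \<in> ball 0 1 \<and> g a' = z \<and> g b' = w \<and>
       poincare_dist a' b' < poincare_dist 0 t + e / 2"
    using perturbed_disc_through_distinct[OF av D(1) const, of 0 t "e / 2"] t \<open>e > 0\<close> by auto
  show ?thesis
  proof (intro exI[of _ d] conjI allI impI \<open>d > 0\<close>, elim conjE)
    fix z w assume "z \<notin> A" "w \<notin> A" "norm (z - f a) < d" "norm (w - f b) < d"
    then show "\<exists>g a' b'. holomorphic_disc (D - A) g \<and> a' \<in> ball 0 1 \<and> b' \<in> ball 0 1 \<and> g a' = z \<and>
        g b' = w \<and> poincare_dist a' b' < poincare_dist a b + e"
      using d[of z w] * True by metis
  qed
qed

section \<open>The infinitesimal metric of the complement\<close>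

lemma kobayashi_metric_set_nonempty:
  assumes "open D" "z \<in> D"
  shows "\<exists>\<zeta> f. holomorphic_disc D f \<and> f 0 = z \<and> \<zeta> *s (\<chi> i. deriv (\<lambda>w. f w $ i) 0) = v"
proof -
  obtain \<rho> where \<rho>: "\<rho> > 0" "ball z \<rho> \<subseteq> D" using assms openE by blast
  \<comment> \<open>The affine disc in direction \<open>v\<close> must fit into the ball of radius
    \<open>\<rho>\<close>; the added 1 covers \<open>v = 0\<close>.\<close>
  define t where "t = \<rho> / (norm v + 1)"
  have "t > 0" using \<rho> by (simp add: t_def add_nonneg_pos)
  have tv: "t * norm v \<le> \<rho>"
    using \<rho>(1) by (simp add: t_def divide_simps add_nonneg_pos)
  define f where "f = (\<lambda>w. z + w *s (complex_of_real t *s v))"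
  have "holomorphic_disc D f"
    unfolding holomorphic_disc_def
  proof (intro conjI allI image_subsetI)
    show "(\<lambda>w. f w $ i) holomorphic_on ball 0 1" for i
      by (auto simp: f_def intro!: holomorphic_intros)
    fix w :: complex assume w: "w \<in> ball 0 1"
    have "norm (w *s (complex_of_real t *s v)) = cmod w * (t * norm v)"
      using \<open>t > 0\<close> by (simp add: norm_smult_complex_vec norm_mult)
    also have "\<dots> \<le> cmod w * \<rho>" by (intro mult_left_mono tv) auto
    also have "\<dots> < 1 * \<rho>" using w \<rho>(1) by (intro mult_strict_right_mono) auto
    finally have "f w \<in> ball z \<rho>" by (simp add: f_def dist_norm norm_minus_commute)
    then show "f w \<in> D" using \<rho>(2) by blast
  qed
  moreover have "deriv (\<lambda>w. f w $ i) 0 = t * v $ i" for i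
    by (rule DERIV_imp_deriv) (auto simp: f_def intro!: derivative_eq_intros)
  ultimately show ?thesis using \<open>t > 0\<close>
    by (intro exI[of _ "1 / complex_of_real t"] exI[of _ f]) (auto simp: f_def vec_eq_iff)
qed

text \<open>The perturbing factor \<open>w\<^sup>2\<close> vanishes to second order at 0, so the
  centre and the derivative there survive, and its only zero is harmless because \<open>z\<close> is
  off \<open>A\<close>. Shrinking multiplies the derivative by \<open>r\<close>, hence a competitor
  \<open>x\<close> for \<open>D\<close> yields the competitor \<open>x / r\<close> for
  \<open>D - A\<close>; then \<open>r\<close> tends to 1.\<close>

lemma kobayashi_metric_diff:
  assumes av: "avoidable A" and D: "open D" "z \<in> D - A"
  shows "kobayashi_metric (D - A) z v = kobayashi_metric D z v"
proof -
  define S where "S = (\<lambda>\<Omega>. {cmod \<zeta> | \<zeta> f. holomorphic_disc \<Omega> f \<and> f 0 = z \<and>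
                      \<zeta> *s (\<chi> i. deriv (\<lambda>w. f w $ i) 0) = v})"
  have bdd: "bdd_below (S \<Omega>)" for \<Omega>
    by (rule bdd_belowI[of _ 0]) (auto simp: S_def)
  have sub: "S (D - A) \<subseteq> S D"
    by (auto simp: S_def holomorphic_disc_def; blast)
  have ne: "S D \<noteq> {}"
    using kobayashi_metric_set_nonempty[OF D(1), of z v] D(2) by (auto simp: S_def)
  have shrink: "x / r \<in> S (D - A)" if x: "x \<in> S D" and r: "0 < r" "r < 1" for x r
  proof -
    obtain \<zeta> f where f: "x = cmod \<zeta>" "holomorphic_disc D f" "f 0 = z"
        "\<zeta> *s (\<chi> i. deriv (\<lambda>w. f w $ i) 0) = v"
      using x by (auto simp: S_def)
    have hf: "(\<lambda>w. f w $ i) holomorphic_on ball 0 1" for i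
      using f(2) by (auto simp: holomorphic_disc_def)
    obtain \<eta> where \<eta>: "\<eta> > 0" "\<And>z y. z \<in> ball 0 1 \<Longrightarrow> norm y < \<eta> \<Longrightarrow> f (of_real r * z) + y \<in> D"
      using shrunk_disc_room[OF f(2) D(1) r] by metis
    obtain c where c: "holomorphic_disc (D - A) (\<lambda>w. f (of_real r * w) + w\<^sup>2 *s c)"
    proof (rule avoidable_disc[OF av, of "\<lambda>w. f (of_real r * w)" "\<lambda>w. w\<^sup>2" 1 \<eta> D])
      show "(\<lambda>w. f (of_real r * w) $ i) holomorphic_on ball 0 1" for i
        by (rule holomorphic_on_shrunk[OF hf r])
      show "cmod (w\<^sup>2) \<le> 1" if "w \<in> ball 0 1" for w
        using that by (simp add: norm_power power_le_one)
      show "f (of_real r * w) \<notin> A" if "w\<^sup>2 = 0" for w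
        using that f(3) D(2) by simp
    qed (use \<eta> in \<open>auto intro!: holomorphic_intros\<close>)
    have "deriv (\<lambda>w. (f (of_real r * w) + w\<^sup>2 *s c) $ i) 0 = deriv (\<lambda>w. f w $ i) 0 * of_real r" for i
    proof (rule DERIV_imp_deriv)
      have "((\<lambda>w. f w $ i) has_field_derivative deriv (\<lambda>w. f w $ i) 0) (at (of_real r * 0))"
        using holomorphic_derivI[OF hf, of 0] by simp
      moreover have "((\<lambda>w. of_real r * w) has_field_derivative of_real r) (at (0::complex))"
        by (auto intro!: derivative_eq_intros)
      ultimately have "((\<lambda>w. f (of_real r * w) $ i) has_field_derivative
          deriv (\<lambda>w. f w $ i) 0 * of_real r) (at 0)"
        by (rule DERIV_chain2)
      then show "((\<lambda>w. (f (of_real r * w) + w\<^sup>2 *s c) $ i) has_field_derivative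
          deriv (\<lambda>w. f w $ i) 0 * of_real r) (at 0)"
        by (auto intro!: derivative_eq_intros)
    qed
    then have "(\<zeta> / of_real r) *s (\<chi> i. deriv (\<lambda>w. (f (of_real r * w) + w\<^sup>2 *s c) $ i) 0) = v"
      using r f(4) by (auto simp: vec_eq_iff)
    moreover have "x / r = cmod (\<zeta> / of_real r)"
      using r f(1) by (simp add: norm_divide)
    ultimately show ?thesis using c f(3) unfolding S_def
      by (intro CollectI exI[of _ "\<zeta> / of_real r"] exI[of _ "\<lambda>w. f (of_real r * w) + w\<^sup>2 *s c"]) auto
  qed
  have "Inf (S (D - A)) \<le> x" if x: "x \<in> S D" for x
  proof -
    have "((\<lambda>r. x / r) \<longlongrightarrow> x / 1) (at_left 1)"
      by (intro tendsto_intros) auto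
    moreover have "eventually (\<lambda>r. Inf (S (D - A)) \<le> x / r) (at_left 1)"
      using shrink[OF x] by (intro eventually_at_leftI[of 0]) (auto intro!: cInf_lower bdd)
    ultimately show ?thesis
      using tendsto_lowerbound[OF _ _ trivial_limit_at_left_real] by force
  qed
  then have "Inf (S (D - A)) \<le> Inf (S D)"
    using ne by (intro cInf_greatest) auto
  moreover have "Inf (S D) \<le> Inf (S (D - A))"
    using sub bdd ne shrink[of _ "1/2"] by (intro cInf_superset_mono) auto
  ultimately show ?thesis
    unfolding kobayashi_metric_def S_def by simp
qed

section \<open>The Kobayashi distance via chains of discs\<close>

text \<open>The chains of \<open>kobayashi_dist\<close>, grown at the right end to allow induction
  along a chain; the link is \<open>disc_chain_iff\<close>. The base case is one disc, matching
  \<open>m \<ge> 1\<close>.\<close>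

inductive disc_chain ::
    "(complex ^ 'n) set \<Rightarrow> complex ^ 'n \<Rightarrow> complex ^ 'n \<Rightarrow> real \<Rightarrow> bool" for \<Omega> where
  single: "\<lbrakk>holomorphic_disc \<Omega> f; a \<in> ball 0 1; b \<in> ball 0 1\<rbrakk> \<Longrightarrow>
     disc_chain \<Omega> (f a) (f b) (poincare_dist a b)"
| step: "\<lbrakk>disc_chain \<Omega> z (f a) s; holomorphic_disc \<Omega> f; a \<in> ball 0 1; b \<in> ball 0 1\<rbrakk> \<Longrightarrow>
     disc_chain \<Omega> z (f b) (s + poincare_dist a b)"

lemma disc_chain_iff:
  "disc_chain \<Omega> z w s \<longleftrightarrow>
     (\<exists>m a b f p. s = (\<Sum>j<m. poincare_dist (a j) (b j)) \<and> m \<ge> 1 \<and> p 0 = z \<and> p m = w \<and>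
        (\<forall>j<m. holomorphic_disc \<Omega> (f j) \<and> a j \<in> ball 0 1 \<and> b j \<in> ball 0 1 \<and>
               f j (a j) = p j \<and> f j (b j) = p (Suc j)))" (is "_ \<longleftrightarrow> ?R z w s")
proof
  assume "disc_chain \<Omega> z w s"
  then show "?R z w s"
  proof induction
    case (single f a b)
    then show ?case
      by (intro exI[of _ 1] exI[of _ "\<lambda>_. a"] exI[of _ "\<lambda>_. b"] exI[of _ "\<lambda>_. f"]
          exI[of _ "\<lambda>j. if j = 0 then f a else f b"]) auto
  next
    case (step z f a s b)
    then obtain m a' b' f' p where IH: "s = (\<Sum>j<m. poincare_dist (a' j) (b' j))" "m \<ge> 1"
      "p 0 = z" "p m = f a"
      "\<forall>j<m. holomorphic_disc \<Omega> (f' j) \<and> a' j \<in> ball 0 1 \<and> b' j \<in> ball 0 1 \<and>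
               f' j (a' j) = p j \<and> f' j (b' j) = p (Suc j)"
      by blast
    define F where "F = f'(m := f)"
    define P where "P = p(Suc m := f b)"
    have "s + poincare_dist a b = (\<Sum>j<Suc m. poincare_dist ((a'(m := a)) j) ((b'(m := b)) j))"
      unfolding IH(1) by simp
    moreover have "P 0 = z" "P (Suc m) = f b" "Suc m \<ge> 1" using IH by (auto simp: P_def)
    moreover have "\<forall>j<Suc m. holomorphic_disc \<Omega> (F j) \<and> (a'(m := a)) j \<in> ball 0 1 \<and>
        (b'(m := b)) j \<in> ball 0 1 \<and> F j ((a'(m := a)) j) = P j \<and> F j ((b'(m := b)) j) = P (Suc j)"
    proof (intro allI impI)
      fix j assume "j < Suc m"
      show "holomorphic_disc \<Omega> (F j) \<and> (a'(m := a)) j \<in> ball 0 1 \<and>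
        (b'(m := b)) j \<in> ball 0 1 \<and> F j ((a'(m := a)) j) = P j \<and> F j ((b'(m := b)) j) = P (Suc j)"
      proof (cases "j = m")
        case True
        then show ?thesis using step.hyps IH(4) by (simp add: F_def P_def)
      next
        case False
        then have "j < m" using \<open>j < Suc m\<close> by simp
        then show ?thesis using IH(5) by (simp add: F_def P_def)
      qed
    qed
    ultimately show ?case by blast
  qed
next
  have "disc_chain \<Omega> (p 0) (p m) (\<Sum>j<m. poincare_dist (a j) (b j))"
    if "m \<ge> 1" "\<forall>j<m. holomorphic_disc \<Omega> (f j) \<and> a j \<in> ball 0 1 \<and> b j \<in> ball 0 1 \<and>
               f j (a j) = p j \<and> f j (b j) = p (Suc j)" for m a b f p
    using that
  proof (induction m rule: nat_induct_at_least)
    case base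
    then show ?case using disc_chain.single[of \<Omega> "f 0" "a 0" "b 0"] by simp
  next
    case (Suc m)
    then have "disc_chain \<Omega> (p 0) (f m (a m)) (\<Sum>j<m. poincare_dist (a j) (b j))" by simp
    then have "disc_chain \<Omega> (p 0) (f m (b m)) ((\<Sum>j<m. poincare_dist (a j) (b j)) + poincare_dist (a m) (b m))"
      using Suc.prems by (intro disc_chain.step) auto
    then show ?case using Suc.prems by simp
  qed
  then show "?R z w s \<Longrightarrow> disc_chain \<Omega> z w s" by blast
qed

lemma kobayashi_dist_eq_Inf:
  assumes "z \<in> \<Omega>" "w \<in> \<Omega>"
  shows "kobayashi_dist \<Omega> z w = Inf {s. disc_chain \<Omega> z w s}"
  using assms unfolding kobayashi_dist_def disc_chain_iff by simp

lemma disc_chain_nonneg: "disc_chain \<Omega> z w s \<Longrightarrow> 0 \<le> s"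
  by (induction rule: disc_chain.induct) (blast intro: poincare_dist_nonneg add_nonneg_nonneg)+

lemma bdd_below_disc_chain: "bdd_below {s. disc_chain \<Omega> z w s}"
  by (rule bdd_belowI[of _ 0]) (auto dest: disc_chain_nonneg)

lemma disc_chain_imp_mem: "disc_chain \<Omega> z w s \<Longrightarrow> z \<in> \<Omega> \<and> w \<in> \<Omega>"
  by (induction rule: disc_chain.induct) (auto simp: holomorphic_disc_def)

lemma kobayashi_dist_le: "disc_chain \<Omega> z w s \<Longrightarrow> kobayashi_dist \<Omega> z w \<le> s"
  using disc_chain_imp_mem[of \<Omega> z w s]
  by (auto simp: kobayashi_dist_eq_Inf intro: cInf_lower bdd_below_disc_chain)

lemma disc_chain_trans:
  assumes "disc_chain \<Omega> u w t" "disc_chain \<Omega> z u s"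
  shows "disc_chain \<Omega> z w (s + t)"
  using assms
proof (induction arbitrary: z s rule: disc_chain.induct)
  case (single f a b)
  then show ?case by (intro disc_chain.step)
next
  case (step u f a t b)
  then show ?case unfolding add.assoc[symmetric] by (intro disc_chain.step) auto
qed

lemma holomorphic_disc_mono: "holomorphic_disc \<Omega> f \<Longrightarrow> \<Omega> \<subseteq> \<Omega>' \<Longrightarrow> holomorphic_disc \<Omega>' f"
  by (auto simp: holomorphic_disc_def)

lemma disc_chain_mono: "disc_chain \<Omega> z w s \<Longrightarrow> \<Omega> \<subseteq> \<Omega>' \<Longrightarrow> disc_chain \<Omega>' z w s"
  by (induction rule: disc_chain.induct) (auto intro: disc_chain.intros holomorphic_disc_mono)

text \<open>An affine disc centred at \<open>z\<close> reaches \<open>w\<close> at parameter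
  \<open>t\<close>, and the norm bound keeps it inside the ball. The pair of parameters 0 and
  \<open>t\<close> has Poincare distance \<open>artanh t\<close>, in either order.\<close>

lemma disc_chain_ball:
  fixes z w :: "complex ^ 'n"
  assumes "ball z r \<subseteq> \<Omega>" "0 < r" "0 < t" "t < 1" "norm (w - z) \<le> t * r"
  shows "disc_chain \<Omega> z w (artanh t)" "disc_chain \<Omega> w z (artanh t)"
proof -
  define f where "f = (\<lambda>\<zeta>. z + \<zeta> *s (complex_of_real (1 / t) *s (w - z)))"
  have hol: "holomorphic_disc \<Omega> f"
    unfolding holomorphic_disc_def
  proof (intro conjI allI image_subsetI)
    show "(\<lambda>\<zeta>. f \<zeta> $ i) holomorphic_on ball 0 1" for i
      by (auto simp: f_def intro!: holomorphic_intros)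
    fix \<zeta> :: complex assume \<zeta>: "\<zeta> \<in> ball 0 1"
    have "norm (\<zeta> *s (complex_of_real (1 / t) *s (w - z))) = cmod \<zeta> * (norm (w - z) / t)"
      using assms unfolding norm_smult_complex_vec by (simp add: norm_divide)
    also have "\<dots> \<le> cmod \<zeta> * r"
      using assms by (intro mult_left_mono) (auto simp: divide_simps mult.commute)
    also have "\<dots> < 1 * r" using \<zeta> assms by (intro mult_strict_right_mono) auto
    finally have "f \<zeta> \<in> ball z r" by (simp add: f_def dist_norm norm_minus_commute)
    then show "f \<zeta> \<in> \<Omega>" using assms by blast
  qed
  have "f 0 = z" "f (of_real t) = w"
    using assms by (auto simp: f_def vec_eq_iff)
  then show "disc_chain \<Omega> z w (artanh t)" "disc_chain \<Omega> w z (artanh t)"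
    using disc_chain.single[OF hol, of 0 "of_real t"] disc_chain.single[OF hol, of "of_real t" 0] assms
    by (auto simp: poincare_dist_0_of_real)
qed

text \<open>Reachability from \<open>z\<close> is locally constant, since any two points of a
  half-radius ball are joined through its centre; connectedness does the rest. This makes the
  infimum defining the distance one over a nonempty set.\<close>

lemma disc_chain_exists:
  fixes \<Omega> :: "(complex ^ 'n) set"
  assumes "open \<Omega>" "connected \<Omega>" "z \<in> \<Omega>" "w \<in> \<Omega>"
  shows "\<exists>s. disc_chain \<Omega> z w s"
proof (rule connected_induction_simple[OF assms(2), of z w])
  show "\<exists>s. disc_chain \<Omega> z z s"
  proof -
    obtain r where "r > 0" "ball z r \<subseteq> \<Omega>" using assms openE by blast
    then show ?thesis using disc_chain_ball[of z r \<Omega> "1/2" z] by auto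
  qed
  fix c assume "c \<in> \<Omega>"
  then obtain r where r: "r > 0" "ball c r \<subseteq> \<Omega>" using assms openE by blast
  have "\<exists>s. disc_chain \<Omega> z y s"
    if "x \<in> ball c (r / 2)" "y \<in> ball c (r / 2)" "disc_chain \<Omega> z x s" for x y s
  proof -
    have "disc_chain \<Omega> x c (artanh (1/2))" "disc_chain \<Omega> c y (artanh (1/2))"
      using disc_chain_ball[OF r(2,1), of "1/2"] that by (auto simp: dist_norm norm_minus_commute)
    then show ?thesis using that(3) disc_chain_trans by blast
  qed
  moreover have "openin (top_of_set \<Omega>) (ball c (r / 2))"
    using r subset_ball[of "r / 2" r c] by (intro open_subset) auto
  ultimately show "\<exists>T. openin (top_of_set \<Omega>) T \<and> c \<in> T \<and>
      (\<forall>x\<in>T. \<forall>y\<in>T. (\<exists>s. disc_chain \<Omega> z x s) \<longrightarrow> (\<exists>s. disc_chain \<Omega> z y s))"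
    using r by (intro exI[of _ "ball c (r / 2)"]) auto
qed (use assms in auto)

text \<open>Images of discs are connected. This lets connectedness of \<open>D - A\<close> be read
  off from its chains.\<close>

lemma disc_chain_connected_component:
  assumes "disc_chain \<Omega> z w s"
  shows "connected_component \<Omega> z w"
proof -
  have disc: "connected_component \<Omega> (f a) (f b)"
    if "holomorphic_disc \<Omega> f" "a \<in> ball 0 1" "b \<in> ball 0 1" for f a b
    unfolding connected_component_def
  proof (intro exI conjI)
    show "connected (f ` ball 0 1)"
      using that(1) by (intro connected_continuous_image holomorphic_vec_continuous_on)
        (auto simp: holomorphic_disc_def)
  qed (use that in \<open>auto simp: holomorphic_disc_def\<close>)
  show ?thesis
    using assms by (induction rule: disc_chain.induct) (blast intro: disc connected_component_trans)+
qed

text \<open>The joints of the given chain may lie in \<open>A\<close>, so the induction must allow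
  the last point to vary over all points off \<open>A\<close> near \<open>w\<close>. The start
  \<open>z\<close> is off \<open>A\<close> and stays fixed. Half of the error goes to the last disc,
  half to the chain before it.\<close>

lemma disc_chain_diff:
  assumes av: "avoidable A" and D: "open D"
    and "disc_chain D z w s" "z \<notin> A" "e > 0"
  shows "\<exists>d>0. \<forall>w'. w' \<notin> A \<and> norm (w' - w) < d \<longrightarrow> (\<exists>s'<s + e. disc_chain (D - A) z w' s')"
  using assms(3-)
proof (induction arbitrary: e rule: disc_chain.induct)
  case (single f a b)
  then show ?case
    using perturbed_disc_through[OF av D single(1-3,5)]
  proof (elim exE conjE)
    fix d assume d: "d > 0" "\<forall>z w. z \<notin> A \<and> w \<notin> A \<and> norm (z - f a) < d \<and> norm (w - f b) < d \<longrightarrow>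
      (\<exists>g a' b'. holomorphic_disc (D - A) g \<and> a' \<in> ball 0 1 \<and> b' \<in> ball 0 1 \<and> g a' = z \<and> g b' = w \<and>
       poincare_dist a' b' < poincare_dist a b + e)"
    have "\<exists>s'<poincare_dist a b + e. disc_chain (D - A) (f a) w' s'"
      if w': "w' \<notin> A" "norm (w' - f b) < d" for w'
    proof -
      have f0: "norm (f a - f a) < d" using d(1) by simp
      obtain g a' b' where "holomorphic_disc (D - A) g" "a' \<in> ball 0 1" "b' \<in> ball 0 1"
        "g a' = f a" "g b' = w'" "poincare_dist a' b' < poincare_dist a b + e"
        using d(2) f0 w' single(4) by blast
      then show ?thesis using disc_chain.single by metis
    qed
    then show ?thesis using d(1) by blast
  qed
next
  case (step z f a s b)
  have e2: "e / 2 > 0" using step.prems by simp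
  obtain d1 where d1: "d1 > 0" "\<And>u w'. u \<notin> A \<Longrightarrow> norm (u - f a) < d1 \<Longrightarrow> w' \<notin> A \<Longrightarrow>
      norm (w' - f b) < d1 \<Longrightarrow>
      \<exists>g a' b'. holomorphic_disc (D - A) g \<and> a' \<in> ball 0 1 \<and> b' \<in> ball 0 1 \<and> g a' = u \<and> g b' = w' \<and>
       poincare_dist a' b' < poincare_dist a b + e / 2"
    using perturbed_disc_through[OF av D step.hyps(2-4) e2] by metis
  obtain d2 where d2: "d2 > 0"
      "\<And>u. u \<notin> A \<Longrightarrow> norm (u - f a) < d2 \<Longrightarrow> \<exists>s'<s + e / 2. disc_chain (D - A) z u s'"
    using step.IH[OF step.prems(1) e2] by metis
  \<comment> \<open>The new joint, off \<open>A\<close> and close enough to the old one both to end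
    the shorter chain and to begin the last disc.\<close>
  obtain u where u: "norm (u - f a) < min d1 d2" "u \<notin> A"
    using avoidable_point_near[OF av, of "min d1 d2" "f a"] d1(1) d2(1) by auto
  obtain s' where s': "s' < s + e / 2" "disc_chain (D - A) z u s'"
    using d2(2)[of u] u by auto
  have "\<exists>s''<s + poincare_dist a b + e. disc_chain (D - A) z w' s''"
    if w': "w' \<notin> A" "norm (w' - f b) < d1" for w'
  proof -
    obtain g a' b' where g: "holomorphic_disc (D - A) g" "a' \<in> ball 0 1" "b' \<in> ball 0 1"
        "g a' = u" "g b' = w'" "poincare_dist a' b' < poincare_dist a b + e / 2"
      using d1(2)[of u w'] u w' by auto
    have "disc_chain (D - A) z (g b') (s' + poincare_dist a' b')"
      using g s'(2) by (intro disc_chain.step) auto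
    moreover have "s' + poincare_dist a' b' < s + poincare_dist a b + e"
      using g(6) s'(1) by linarith
    ultimately show ?thesis using g(5) by blast
  qed
  then show ?case using d1(1) by blast
qed

text \<open>\<open>A\<close> does not disconnect \<open>D\<close>: a chain of \<open>D\<close>
  between points off \<open>A\<close> can be replaced by a chain of \<open>D - A\<close>.\<close>

lemma is_domain_diff:
  fixes D :: "(complex ^ 'n) set"
  assumes av: "avoidable A" "closed A" and D: "is_domain D"
  shows "is_domain (D - A)"
proof -
  have oc: "open D" "connected D" "D \<noteq> {}" using D by (auto simp: is_domain_def)
  obtain u where "u \<in> D" using oc by blast
  then obtain r where r: "r > 0" "ball u r \<subseteq> D" using oc openE by blast
  obtain u' where "norm (u' - u) < r" "u' \<notin> A" using avoidable_point_near[OF av(1) r(1)] by blast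
  then have "u' \<in> D - A" using r by (auto simp: dist_norm norm_minus_commute)
  moreover have "connected_component (D - A) z w" if zw: "z \<in> D - A" "w \<in> D - A" for z w
  proof -
    obtain s where "disc_chain D z w s" using disc_chain_exists[OF oc(1,2), of z w] zw by blast
    then obtain d where d: "d > 0" "\<And>w'. w' \<notin> A \<Longrightarrow> norm (w' - w) < d \<Longrightarrow> \<exists>s'<s + 1. disc_chain (D - A) z w' s'"
      using disc_chain_diff[OF av(1) oc(1), of z w s 1] zw(1) by auto
    obtain s' where "disc_chain (D - A) z w s'" using d(2)[of w] d(1) zw(2) by auto
    then show ?thesis by (rule disc_chain_connected_component)
  qed
  ultimately show ?thesis
    using av oc by (auto simp: is_domain_def connected_iff_connected_component)
qed

text \<open>Discs of \<open>D - A\<close> are discs of \<open>D\<close>, which gives one inequality.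
  For the other, \<open>disc_chain_diff\<close> with end point \<open>w\<close> itself replaces a
  chain at an arbitrarily small extra cost.\<close>

lemma kobayashi_dist_diff:
  fixes D :: "(complex ^ 'n) set"
  assumes av: "avoidable A" and D: "is_domain D" and zw: "z \<in> D - A" "w \<in> D - A"
  shows "kobayashi_dist (D - A) z w = kobayashi_dist D z w"
proof -
  have oc: "open D" "connected D" using D by (auto simp: is_domain_def)
  obtain s0 where s0: "disc_chain D z w s0" using disc_chain_exists oc zw by blast
  have approx: "\<exists>s'<s + e. disc_chain (D - A) z w s'" if "disc_chain D z w s" "e > 0" for s e
    using disc_chain_diff[OF av oc(1) that(1) _ that(2)] zw by fastforce
  have "Inf {s. disc_chain (D - A) z w s} \<le> s" if s: "disc_chain D z w s" for s
  proof (rule field_le_epsilon)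
    fix e :: real assume "e > 0"
    then obtain s' where "s' < s + e" "disc_chain (D - A) z w s'" using approx s by blast
    then show "Inf {s. disc_chain (D - A) z w s} \<le> s + e"
      using cInf_lower[OF _ bdd_below_disc_chain, of s' "D - A" z w] by simp
  qed
  then have "Inf {s. disc_chain (D - A) z w s} \<le> Inf {s. disc_chain D z w s}"
    using s0 by (intro cInf_greatest) auto
  moreover have "Inf {s. disc_chain D z w s} \<le> Inf {s. disc_chain (D - A) z w s}"
    using approx[OF s0, of 1] by (intro cInf_superset_mono bdd_below_disc_chain) (auto intro: disc_chain_mono)
  ultimately show ?thesis using zw by (auto simp: kobayashi_dist_eq_Inf)
qed

text \<open>Finitely many half-radius balls cover \<open>K\<close>; a point goes to the centre of
  its ball at cost \<open>artanh (1/2)\<close>, and finitely many chains join the centres. The sum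
  \<open>M\<close> of their lengths bounds each of them.\<close>

lemma kobayashi_dist_bounded_on_compact:
  fixes \<Omega> :: "(complex ^ 'n) set"
  assumes "open \<Omega>" "connected \<Omega>" "compact K" "K \<subseteq> \<Omega>"
  shows "\<exists>B. \<forall>x\<in>K. \<forall>y\<in>K. kobayashi_dist \<Omega> x y \<le> B"
proof -
  have "\<exists>r>0. ball c r \<subseteq> \<Omega>" if "c \<in> K" for c
    using that assms openE by blast
  then obtain r where r: "\<And>c. c \<in> K \<Longrightarrow> r c > 0" "\<And>c. c \<in> K \<Longrightarrow> ball c (r c) \<subseteq> \<Omega>"
    by metis
  have "K \<subseteq> (\<Union>c\<in>K. ball c (r c / 2))" using r(1) by force
  then obtain C where C: "C \<subseteq> K" "finite C" "K \<subseteq> (\<Union>c\<in>C. ball c (r c / 2))"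
    using compactE_image[OF assms(3), of K "\<lambda>c. ball c (r c / 2)"] by auto
  have "\<forall>c\<in>C. \<forall>c'\<in>C. \<exists>s. disc_chain \<Omega> c c' s"
    using disc_chain_exists assms C(1) by blast
  then obtain S where S: "\<And>c c'. c \<in> C \<Longrightarrow> c' \<in> C \<Longrightarrow> disc_chain \<Omega> c c' (S c c')" by metis
  define M where "M = (\<Sum>c\<in>C. \<Sum>c'\<in>C. S c c')"
  have M: "S c c' \<le> M" if "c \<in> C" "c' \<in> C" for c c'
  proof -
    have "S c c' \<le> (\<Sum>c'\<in>C. S c c')"
      using that C(2) S by (intro member_le_sum) (auto intro: disc_chain_nonneg)
    also have "\<dots> \<le> M"
      unfolding M_def using that C(2) S
      by (intro member_le_sum[of c C "\<lambda>c. \<Sum>c'\<in>C. S c c'"] sum_nonneg) (auto intro: disc_chain_nonneg)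
    finally show ?thesis .
  qed
  have "kobayashi_dist \<Omega> x y \<le> artanh (1/2) + M + artanh (1/2)" if xy: "x \<in> K" "y \<in> K" for x y
  proof -
    obtain c c' where c: "c \<in> C" "x \<in> ball c (r c / 2)" "c' \<in> C" "y \<in> ball c' (r c' / 2)"
      using xy C(3) by blast
    have "disc_chain \<Omega> x c (artanh (1/2))"
      using c C(1) r by (intro disc_chain_ball[of c "r c"]) (auto simp: dist_norm norm_minus_commute subset_iff)
    moreover have "disc_chain \<Omega> c' y (artanh (1/2))"
      using c C(1) r by (intro disc_chain_ball[of c' "r c'"]) (auto simp: dist_norm norm_minus_commute subset_iff)
    ultimately have "disc_chain \<Omega> x y (artanh (1/2) + S c c' + artanh (1/2))"
      using S[OF c(1,3)] disc_chain_trans by blast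
    then have "kobayashi_dist \<Omega> x y \<le> artanh (1/2) + S c c' + artanh (1/2)"
      by (rule kobayashi_dist_le)
    then show ?thesis using M[OF c(1,3)] by linarith
  qed
  then show ?thesis by blast
qed

section \<open>Euclidean lower bounds for the distance and the metric\<close>

text \<open>A Moebius map moves \<open>a\<close> to 0; after subtracting \<open>F a\<close> the
  function is bounded by \<open>2 * R\<close>, and the Schwarz lemma applies to the quotient
  \<open>h\<close>. The point \<open>\<xi>\<close> corresponding to \<open>b\<close> has modulus at
  most the Poincare distance.\<close>

lemma Schwarz_Pick_bounded:
  fixes F :: "complex \<Rightarrow> complex"
  assumes F: "F holomorphic_on ball 0 1" "\<And>z. z \<in> ball 0 1 \<Longrightarrow> cmod (F z) < R"
    and ab: "a \<in> ball 0 1" "b \<in> ball 0 1"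
  shows "cmod (F a - F b) \<le> 2 * R * poincare_dist a b"
proof -
  have "R > 0" using F(2)[of 0] norm_ge_zero le_less_trans by (metis centre_in_ball zero_less_one)
  define h where "h = (\<lambda>\<zeta>. (F (Moebius_function 0 (-a) \<zeta>) - F a) / of_real (2 * R))"
  define \<xi> where "\<xi> = Moebius_function 0 a b"
  have a: "cmod (-a) < 1" "cmod a < 1" "cmod b < 1" using ab by auto
  have maps: "Moebius_function 0 (-a) \<zeta> \<in> ball 0 1" if "cmod \<zeta> < 1" for \<zeta>
    using Moebius_function_norm_lt_1[OF a(1) that] by simp
  have "norm (h \<xi>) \<le> norm \<xi>"
  proof (rule Schwarz_Lemma(1))
    have "(F \<circ> Moebius_function 0 (-a)) holomorphic_on ball 0 1"
      using maps by (intro holomorphic_on_compose_gen[OF Moebius_function_holomorphic[OF a(1)] F(1)]) auto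
    then show "h holomorphic_on ball 0 1"
      using \<open>R > 0\<close> unfolding h_def o_def by (intro holomorphic_intros) auto
    show "h 0 = 0" by (simp add: h_def Moebius_function_of_zero)
    show "norm (h \<zeta>) < 1" if "norm \<zeta> < 1" for \<zeta>
    proof -
      have "cmod (F (Moebius_function 0 (-a) \<zeta>) - F a) < 2 * R"
        using F(2)[OF maps[OF that]] F(2)[OF ab(1)]
          norm_triangle_ineq4[of "F (Moebius_function 0 (-a) \<zeta>)" "F a"] by linarith
      then show ?thesis using \<open>R > 0\<close> by (simp add: h_def norm_divide norm_mult)
    qed
    show "norm \<xi> < 1" unfolding \<xi>_def by (rule Moebius_function_norm_lt_1) (use a in auto)
  qed
  moreover have "Moebius_function 0 (-a) \<xi> = b"
    unfolding \<xi>_def using Moebius_function_compose[of "-a" a b] a by simp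
  ultimately have "cmod (F b - F a) \<le> 2 * R * cmod \<xi>"
    using \<open>R > 0\<close> by (simp add: h_def norm_divide norm_mult divide_simps mult.commute)
  also have "cmod \<xi> \<le> poincare_dist a b"
    using poincare_dist_ge[OF ab]
    by (simp add: \<xi>_def Moebius_function_simple norm_divide norm_minus_commute)
  finally show ?thesis using \<open>R > 0\<close> by (simp add: norm_minus_commute)
qed

lemma disc_chain_ge:
  assumes "\<Omega> \<subseteq> ball 0 R" "disc_chain \<Omega> z w s"
  shows "cmod (z $ i - w $ i) \<le> 2 * R * s"
proof -
  have disc: "cmod (f a $ i - f b $ i) \<le> 2 * R * poincare_dist a b"
    if "holomorphic_disc \<Omega> f" "a \<in> ball 0 1" "b \<in> ball 0 1" for f a b
  proof (rule Schwarz_Pick_bounded)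
    show "(\<lambda>z. f z $ i) holomorphic_on ball 0 1" using that by (auto simp: holomorphic_disc_def)
    show "cmod (f x $ i) < R" if "x \<in> ball 0 1" for x
      using \<open>holomorphic_disc \<Omega> f\<close> that assms(1) Finite_Cartesian_Product.norm_nth_le[of "f x" i]
      by (force simp: holomorphic_disc_def image_subset_iff)
  qed (use that in auto)
  show ?thesis using assms(2)
  proof (induction rule: disc_chain.induct)
    case (single f a b)
    then show ?case by (rule disc)
  next
    case (step z f a s b)
    have "cmod (z $ i - f b $ i) \<le> cmod (z $ i - f a $ i) + cmod (f a $ i - f b $ i)"
      using norm_triangle_ineq[of "z $ i - f a $ i" "f a $ i - f b $ i"] by simp
    then show ?case using step.IH disc[OF step.hyps(2-4)] by (simp add: algebra_simps)
  qed
qed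

text \<open>The coordinates are bounded holomorphic functions along each disc, and their increments
  add up along a chain. Hence Kobayashi convergence forces Euclidean convergence.\<close>

lemma kobayashi_dist_ge:
  fixes \<Omega> :: "(complex ^ 'n) set"
  assumes "open \<Omega>" "connected \<Omega>" "\<Omega> \<subseteq> ball 0 R" "R > 0" "z \<in> \<Omega>" "w \<in> \<Omega>"
  shows "cmod (z $ i - w $ i) \<le> 2 * R * kobayashi_dist \<Omega> z w"
proof -
  have "cmod (z $ i - w $ i) / (2 * R) \<le> Inf {s. disc_chain \<Omega> z w s}"
    using disc_chain_exists[OF assms(1,2,5,6)] disc_chain_ge[OF assms(3)] assms(4)
    by (intro cInf_greatest) (auto simp: divide_simps mult.commute)
  then show ?thesis using assms by (simp add: kobayashi_dist_eq_Inf divide_simps mult.commute)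
qed

text \<open>The Cauchy estimate on the circle of radius 1/2 gives \<open>2 * R\<close> for each
  coordinate of the derivative, and summing the coordinates gives the factor
  \<open>CARD('n)\<close>. A bound on the Kobayashi speed thus bounds the Euclidean speed.\<close>

lemma kobayashi_metric_ge:
  fixes \<Omega> :: "(complex ^ 'n) set"
  assumes "open \<Omega>" "\<Omega> \<subseteq> ball 0 R" "R > 0" "z \<in> \<Omega>"
  shows "norm v \<le> real CARD('n) * (2 * R) * kobayashi_metric \<Omega> z v"
proof -
  let ?C = "real CARD('n) * (2 * R)"
  have "?C > 0" using assms by simp
  have "norm v \<le> ?C * cmod \<zeta>"
    if f: "holomorphic_disc \<Omega> f" "\<zeta> *s (\<chi> i. deriv (\<lambda>w. f w $ i) 0) = v" for \<zeta> f
  proof -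
    have comp: "cmod (v $ i) \<le> 2 * R * cmod \<zeta>" for i
    proof -
      have hol: "(\<lambda>w. f w $ i) holomorphic_on ball 0 1" using f by (auto simp: holomorphic_disc_def)
      have bd: "cmod (f x $ i) \<le> R" if "x \<in> ball 0 1" for x
        using f(1) that assms(2) Finite_Cartesian_Product.norm_nth_le[of "f x" i]
        by (force simp: holomorphic_disc_def image_subset_iff)
      have "norm ((deriv ^^ 1) (\<lambda>w. f w $ i) 0) \<le> fact 1 * R / (1/2) ^ 1"
        by (rule Cauchy_inequality)
          (auto intro!: holomorphic_on_subset[OF hol] holomorphic_on_imp_continuous_on bd)
      then have "cmod (deriv (\<lambda>w. f w $ i) 0) \<le> 2 * R" by simp
      then have "cmod \<zeta> * cmod (deriv (\<lambda>w. f w $ i) 0) \<le> cmod \<zeta> * (2 * R)"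
        by (intro mult_left_mono) auto
      then show ?thesis by (simp add: norm_mult mult.commute flip: f(2))
    qed
    have "norm v \<le> (\<Sum>i\<in>UNIV. cmod (v $ i))"
      unfolding norm_vec_def by (rule L2_set_le_sum) auto
    also have "\<dots> \<le> (\<Sum>i\<in>(UNIV :: 'n set). 2 * R * cmod \<zeta>)" by (intro sum_mono comp)
    also have "\<dots> = ?C * cmod \<zeta>" by simp
    finally show ?thesis .
  qed
  then have "norm v / ?C \<le> kobayashi_metric \<Omega> z v"
    unfolding kobayashi_metric_def
    using kobayashi_metric_set_nonempty[OF assms(1,4), of v] \<open>?C > 0\<close>
    by (intro cInf_greatest) (auto simp: divide_simps mult.commute)
  then show ?thesis using \<open>?C > 0\<close> by (simp add: divide_simps mult.commute)
qed

section \<open>Absolutely continuous curves with bounded derivative\<close>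

text \<open>A fine division splits the increment: over intervals tagged at a point of differentiability
  the curve moves by at most \<open>M + \<epsilon>\<close> times their length, and the others lie in an open set of
  measure less than \<open>\<delta>\<close>, where absolute continuity applies.\<close>

lemma absolutely_continuous_curve_increment:
  fixes \<sigma> :: "real \<Rightarrow> 'a::real_normed_vector"
  assumes ac: "absolutely_continuous_curve {a..b} \<sigma>" and "M \<ge> 0"
    and AE: "AE t in lebesgue_on {a..b}. \<sigma> differentiable (at t within {a..b}) \<and>
      norm (vector_derivative \<sigma> (at t within {a..b})) \<le> M"
    and cd: "c \<le> d" "{c..d} \<subseteq> {a..b}"
  shows "norm (\<sigma> d - \<sigma> c) \<le> M * (d - c)"
proof (rule field_le_epsilon)
  fix e' :: real assume "e' > 0"
  \<comment> \<open>The total error is \<open>e * (d - c)\<close> from the intervals with good tags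
    plus \<open>e\<close> from the others, which makes exactly \<open>e'\<close>.\<close>
  define e where "e = e' / (d - c + 1)"
  have "e > 0" using cd \<open>e' > 0\<close> by (simp add: e_def)
  obtain \<delta> where \<delta>: "\<delta> > 0" "\<And>\<D> S. \<D> division_of S \<Longrightarrow> S \<subseteq> {a..b} \<Longrightarrow> (\<Sum>J\<in>\<D>. Sup J - Inf J) < \<delta> \<Longrightarrow>
      (\<Sum>J\<in>\<D>. norm (\<sigma> (Sup J) - \<sigma> (Inf J))) < e"
    using ac \<open>e > 0\<close> unfolding absolutely_continuous_curve_def by meson
  obtain N where N: "{x \<in> space (lebesgue_on {a..b}). \<not> (\<sigma> differentiable (at x within {a..b}) \<and>
      norm (vector_derivative \<sigma> (at x within {a..b})) \<le> M)} \<subseteq> N"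
      "emeasure (lebesgue_on {a..b}) N = 0" "N \<in> sets (lebesgue_on {a..b})"
    using AE_E[OF AE] by blast
  have "N \<in> null_sets (lebesgue_on {a..b})" using N by blast
  then have null: "N \<in> null_sets lebesgue" by (simp add: null_sets_restrict_space)
  then have "N \<in> sets lebesgue" by blast
  then obtain U where U: "open U" "N \<subseteq> U" "U - N \<in> lmeasurable" "emeasure lebesgue (U - N) < ennreal \<delta>"
    using sets_lebesgue_outer_open \<delta>(1) by metis
  have "U \<in> sets lebesgue" using U(1) by auto
  then have "emeasure lebesgue U < ennreal \<delta>"
    using U(4) null by (simp add: emeasure_Diff_null_set)
  moreover from this have Um: "U \<in> lmeasurable"
    using \<open>U \<in> sets lebesgue\<close> by (intro fmeasurableI) (auto simp: less_top[symmetric] intro: less_trans)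
  ultimately have mU: "measure lebesgue U < \<delta>"
    by (simp add: emeasure_eq_measure2 ennreal_less_iff)
  have "\<exists>r>0. \<forall>y\<in>{a..b}. \<bar>y - t\<bar> < r \<longrightarrow> norm (\<sigma> y - \<sigma> t) \<le> (M + e) * \<bar>y - t\<bar>" if t: "t \<in> {a..b} - N" for t
  proof -
    let ?v = "vector_derivative \<sigma> (at t within {a..b})"
    have "\<sigma> differentiable (at t within {a..b})" and v: "norm ?v \<le> M"
      using t N(1) by auto
    then have "(\<sigma> has_derivative (\<lambda>x. x *\<^sub>R ?v)) (at t within {a..b})"
      by (simp add: vector_derivative_works has_vector_derivative_def)
    then obtain r where r: "r > 0" "\<And>y. y \<in> {a..b} \<Longrightarrow> norm (y - t) < r \<Longrightarrow>
        norm (\<sigma> y - \<sigma> t - (y - t) *\<^sub>R ?v) \<le> e * norm (y - t)"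
      using \<open>e > 0\<close> unfolding has_derivative_within_alt by meson
    have "norm (\<sigma> y - \<sigma> t) \<le> (M + e) * \<bar>y - t\<bar>" if y: "y \<in> {a..b}" "\<bar>y - t\<bar> < r" for y
    proof -
      have "norm (\<sigma> y - \<sigma> t) \<le> norm (\<sigma> y - \<sigma> t - (y - t) *\<^sub>R ?v) + norm ((y - t) *\<^sub>R ?v)"
        using norm_triangle_ineq[of "\<sigma> y - \<sigma> t - (y - t) *\<^sub>R ?v" "(y - t) *\<^sub>R ?v"] by simp
      also have "\<dots> \<le> e * \<bar>y - t\<bar> + \<bar>y - t\<bar> * M"
        using r(2)[OF y(1)] y(2) v by (intro add_mono) (auto intro: mult_left_mono)
      finally show ?thesis by (simp add: algebra_simps)
    qed
    then show ?thesis using r(1) by blast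
  qed
  then obtain r where r: "\<And>t. t \<in> {a..b} - N \<Longrightarrow> r t > 0"
      "\<And>t y. t \<in> {a..b} - N \<Longrightarrow> y \<in> {a..b} \<Longrightarrow> \<bar>y - t\<bar> < r t \<Longrightarrow> norm (\<sigma> y - \<sigma> t) \<le> (M + e) * \<bar>y - t\<bar>"
    by metis
  \<comment> \<open>A tag in \<open>N\<close> forces its interval into \<open>U\<close>; a good tag
    keeps it where the derivative estimate holds. The unit ball outside \<open>{a..b}\<close> only
    makes \<open>\<gamma>\<close> a gauge on the whole line.\<close>
  define \<gamma> where "\<gamma> = (\<lambda>t. if t \<in> N then U else if t \<in> {a..b} then ball t (r t) else ball t 1)"
  have "gauge \<gamma>"
    using r(1) U by (auto simp: gauge_def \<gamma>_def)
  then obtain p where p: "p tagged_division_of {c..d}" "\<gamma> fine p"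
    using fine_division_exists_real by blast
  have fin: "finite p" using p(1) by auto
  define p2 where "p2 = {xk \<in> p. fst xk \<in> N}"
  define F where "F = (\<lambda>K. if K = {} then 0 else norm (\<sigma> (Sup K) - \<sigma> (Inf K)))"
  have ival: "\<exists>u v. K = {u..v} \<and> u \<le> x \<and> x \<le> v \<and> {u..v} \<subseteq> {a..b} \<and> x \<in> {a..b}" if "(x, K) \<in> p" for x K
    using tagged_division_ofD(2,3,4)[OF p(1) that] cd(2)
    by (metis atLeastAtMost_iff box_real(2) order_trans subsetD)
  have good: "F K \<le> (M + e) * measure lborel K" if xK: "(x, K) \<in> p - p2" for x K
  proof -
    obtain u v where uv: "K = {u..v}" "u \<le> x" "x \<le> v" "{u..v} \<subseteq> {a..b}" "x \<in> {a..b}"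
      using ival xK by blast
    have x: "x \<in> {a..b} - N" using xK uv(5) by (auto simp: p2_def)
    have "K \<subseteq> \<gamma> x" using p(2) xK by (auto simp: fine_def)
    then have "{u..v} \<subseteq> ball x (r x)" using x uv(1) by (simp add: \<gamma>_def)
    moreover have uvm: "u \<in> {u..v}" "v \<in> {u..v}" using uv(2,3) by auto
    ultimately have "u \<in> ball x (r x)" "v \<in> ball x (r x)" by blast+
    then have ur: "\<bar>u - x\<bar> < r x" "\<bar>v - x\<bar> < r x"
      by (simp_all add: dist_real_def abs_minus_commute)
    have "norm (\<sigma> u - \<sigma> x) \<le> (M + e) * \<bar>u - x\<bar>" "norm (\<sigma> v - \<sigma> x) \<le> (M + e) * \<bar>v - x\<bar>"
      by (intro r(2)[OF x] ur subsetD[OF uv(4)] uvm)+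
    moreover have "norm (\<sigma> v - \<sigma> u) \<le> norm (\<sigma> v - \<sigma> x) + norm (\<sigma> u - \<sigma> x)"
      using norm_triangle_ineq4[of "\<sigma> v - \<sigma> x" "\<sigma> u - \<sigma> x"] by simp
    ultimately have "norm (\<sigma> v - \<sigma> u) \<le> (M + e) * (v - u)"
      using uv(2,3) by (simp add: algebra_simps)
    then show ?thesis using uv(1-3) by (auto simp: F_def)
  qed
  have bad: "(\<Sum>(x, K)\<in>p2. F K) < e"
  proof -
    have "p2 tagged_partial_division_of {c..d}"
      using tagged_partial_division_subset[of p "{c..d}" p2] p(1)
      by (auto simp: p2_def tagged_division_of_def)
    then have p2: "p2 tagged_division_of \<Union>(snd ` p2)"
      by (rule tagged_partial_division_of_Union_self)
    \<comment> \<open>Absolute continuity speaks of a set of intervals, whereas \<open>p2\<close>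
      carries tags, and a one-point interval may occur with several tags. On such intervals, and on
      the empty set by its definition, \<open>F\<close> vanishes, so both sums agree.\<close>
    have "(\<Sum>(x, K)\<in>p2. F K) = sum F (snd ` p2)"
    proof (rule sum.over_tagged_division_lemma[OF p2])
      fix u v :: real assume "box u v = {}"
      then show "F (cbox u v) = 0" by (cases "u = v") (auto simp: F_def)
    qed
    also have "\<dots> = (\<Sum>K\<in>snd ` p2. norm (\<sigma> (Sup K) - \<sigma> (Inf K)))"
      using ival by (intro sum.cong) (force simp: F_def p2_def)+
    also have "\<dots> < e"
    proof (rule \<delta>(2)[OF division_of_tagged_division[OF p2]])
      show "\<Union>(snd ` p2) \<subseteq> {a..b}" using ival by (force simp: p2_def)
      have "(\<Sum>J\<in>snd ` p2. Sup J - Inf J) = (\<Sum>J\<in>snd ` p2. measure lebesgue J)"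
      proof (rule sum.cong[OF refl])
        fix J assume "J \<in> snd ` p2"
        then obtain u v where "J = {u..v}" "u \<le> v" using ival by (force simp: p2_def)
        then show "Sup J - Inf J = measure lebesgue J" by simp
      qed
      also have "\<dots> = measure lebesgue (\<Union>(snd ` p2))"
        by (rule content_division[OF division_of_tagged_division[OF p2]])
      also have "\<dots> \<le> measure lebesgue U"
      proof (rule measure_mono_fmeasurable[OF _ _ Um])
        show "\<Union>(snd ` p2) \<subseteq> U"
          using p(2) by (fastforce simp: p2_def fine_def \<gamma>_def)
        show "\<Union>(snd ` p2) \<in> sets lebesgue"
          using lmeasurable_division[OF division_of_tagged_division[OF p2]] by blast
      qed
      also note mU
      finally show "(\<Sum>J\<in>snd ` p2. Sup J - Inf J) < \<delta>" .
    qed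
    finally show ?thesis .
  qed
  have "\<sigma> d - \<sigma> c = (\<Sum>(x, K)\<in>p. \<sigma> (Sup K) - \<sigma> (Inf K))"
    by (rule additive_tagged_division_1[OF cd(1) p(1), symmetric])
  also have "norm \<dots> \<le> (\<Sum>(x, K)\<in>p. F K)"
    using ival by (intro sum_norm_le) (fastforce simp: F_def)
  also have "\<dots> = (\<Sum>(x, K)\<in>p - p2. F K) + (\<Sum>(x, K)\<in>p2. F K)"
    using fin by (intro sum.subset_diff) (auto simp: p2_def)
  also have "(\<Sum>(x, K)\<in>p - p2. F K) \<le> (\<Sum>(x, K)\<in>p - p2. (M + e) * measure lborel K)"
    using good by (intro sum_mono) auto
  also have "\<dots> \<le> (\<Sum>(x, K)\<in>p. (M + e) * measure lborel K)"
    using fin \<open>M \<ge> 0\<close> \<open>e > 0\<close> by (intro sum_mono2) auto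
  also have "\<dots> = (M + e) * (d - c)"
    using additive_content_tagged_division[of p c d] p(1) cd(1)
    by (simp add: sum_distrib_left[symmetric] split_def)
  also note bad
  also have "(M + e) * (d - c) + e = M * (d - c) + e * (d - c + 1)"
    by (simp add: algebra_simps)
  also have "e * (d - c + 1) = e'" using cd(1) by (simp add: e_def)
  finally show "norm (\<sigma> d - \<sigma> c) \<le> M * (d - c) + e'" by simp
qed

lemma absolutely_continuous_curve_lipschitz:
  fixes \<sigma> :: "real \<Rightarrow> 'a::real_normed_vector"
  assumes "absolutely_continuous_curve {a..b} \<sigma>" and "M \<ge> 0"
    and "AE t in lebesgue_on {a..b}. \<sigma> differentiable (at t within {a..b}) \<and>
      norm (vector_derivative \<sigma> (at t within {a..b})) \<le> M"
  shows "M-lipschitz_on {a..b} \<sigma>"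
proof (rule lipschitz_onI[OF _ assms(2)])
  fix s t assume st: "s \<in> {a..b}" "t \<in> {a..b}"
  show "dist (\<sigma> s) (\<sigma> t) \<le> M * dist s t"
    using absolutely_continuous_curve_increment[OF assms, of s t]
      absolutely_continuous_curve_increment[OF assms, of t s] st
    by (cases "s \<le> t") (auto simp: dist_norm norm_minus_commute)
qed

section \<open>Pseudo-arcs, pseudoconvexity and completeness\<close>

text \<open>An arc is the union of its two halves.\<close>

lemma pseudo_arc_no_arc:
  assumes "pseudo_arc P" "arc g"
  shows "\<not> path_image g \<subseteq> P"
proof
  assume sub: "path_image g \<subseteq> P"
  have cont: "continuous_on {0..1} g" and inj: "inj_on g {0..1}"
    using assms(2) by (auto simp: arc_def path_def)
  let ?E = "g ` {0..1/2}" and ?F = "g ` {1/2..1}"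
  have "{0..1::real} = {0..1/2} \<union> {1/2..1}" by auto
  then have un: "path_image g = ?E \<union> ?F"
    unfolding path_image_def by (metis image_Un)
  have "compact ?E" "compact ?F" "connected ?E" "connected ?F"
    by (intro compact_continuous_image connected_continuous_image continuous_on_subset[OF cont]; auto)+
  moreover have "g 1 \<notin> ?E" "g 0 \<notin> ?F"
    using inj by (auto dest!: inj_onD)
  then have "?E \<subset> path_image g" "?F \<subset> path_image g"
    unfolding un by auto
  moreover have "?E \<noteq> {}" "?F \<noteq> {}" by auto
  moreover have "compact (path_image g)" "connected (path_image g)"
    using assms(2) by (auto intro: compact_arc_image connected_arc_image)
  ultimately have "\<exists>E F. E \<noteq> {} \<and> E \<subset> path_image g \<and> compact E \<and> connected E \<and>
      F \<noteq> {} \<and> F \<subset> path_image g \<and> compact F \<and> connected F \<and> path_image g = E \<union> F"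
    using un by blast
  then show False
    using assms(1) sub \<open>compact (path_image g)\<close> \<open>connected (path_image g)\<close>
    unfolding pseudo_arc_def by blast
qed

text \<open>A path with distinct ends contains an arc, and the continuous injective inverse of
  \<open>\<psi>\<close> carries that arc into \<open>P\<close>.\<close>

lemma bi_lipschitz_pseudo_arc_no_path:
  fixes \<psi> :: "real ^ 2 \<Rightarrow> complex ^ 'n"
  assumes P: "pseudo_arc P" and bi: "bi_lipschitz_on P \<psi>"
    and p: "path p" "path_image p \<subseteq> \<psi> ` P"
  shows "pathstart p = pathfinish p"
proof (rule ccontr)
  assume "pathstart p \<noteq> pathfinish p"
  then obtain q where q: "arc q" "path_image q \<subseteq> path_image p"
    using path_contains_arc p(1) by metis
  obtain M where M: "M-lipschitz_on (\<psi> ` P) (inv_into P \<psi>)"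
    using bi by (auto simp: bi_lipschitz_on_def)
  have sub: "path_image q \<subseteq> \<psi> ` P" using q p by blast
  have "arc (inv_into P \<psi> \<circ> q)"
    unfolding arc_def
  proof
    show "path (inv_into P \<psi> \<circ> q)"
      using q(1) by (intro path_continuous_image arc_imp_path
          continuous_on_subset[OF lipschitz_on_continuous_on[OF M] sub])
    show "inj_on (inv_into P \<psi> \<circ> q) {0..1}"
      using q(1) inj_on_inv_into[OF sub] by (auto simp: arc_def path_image_def intro: comp_inj_on)
  qed
  moreover have "path_image (inv_into P \<psi> \<circ> q) \<subseteq> P"
    using sub by (auto simp: path_image_compose intro!: inv_into_into)
  ultimately show False using pseudo_arc_no_arc[OF P] by blast
qed

section \<open>Failure of pseudoconvexity\<close>

lemma orthogonal_complex_vec: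
  fixes a :: "complex ^ 'n"
  assumes "CARD('n) \<ge> 2" "a \<noteq> 0"
  shows "\<exists>w. w \<noteq> 0 \<and> (\<Sum>k\<in>UNIV. a $ k * cnj (w $ k)) = 0"
proof -
  obtain i where i: "a $ i \<noteq> 0" using assms(2) by (auto simp: vec_eq_iff)
  obtain j where j: "j \<noteq> i"
    using assms(1) card_le_Suc0_iff_eq[of "UNIV :: 'n set"] by (metis UNIV_I finite not_less_eq_eq numeral_2_eq_2)
  \<comment> \<open>Two coordinates of \<open>a\<close> are swapped, conjugated and given opposite
    signs; the Hermitian product becomes \<open>a $ i * a $ j - a $ j * a $ i\<close>.\<close>
  define w where "w = axis i (cnj (a $ j)) - axis j (cnj (a $ i))"
  have "w $ j \<noteq> 0" using i j by (simp add: w_def axis_def)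
  moreover have "(\<Sum>k\<in>UNIV. a $ k * cnj (w $ k)) =
      (\<Sum>k\<in>UNIV. (if k = i then a $ i * a $ j else 0) - (if k = j then a $ j * a $ i else 0))"
    by (intro sum.cong) (auto simp: w_def axis_def)
  then have "(\<Sum>k\<in>UNIV. a $ k * cnj (w $ k)) = 0"
    by (simp add: sum_subtractf)
  ultimately show ?thesis by (intro exI[of _ w]) auto
qed

text \<open>Pythagoras. Hermitian orthogonality removes the cross term for every complex
  \<open>\<zeta>\<close>, so the whole complex line in direction \<open>w\<close> is tangent to the
  sphere, not just a real line.\<close>

lemma norm_add_orthogonal_complex_vec:
  fixes a w :: "complex ^ 'n"
  assumes "(\<Sum>k\<in>UNIV. a $ k * cnj (w $ k)) = 0"
  shows "(norm (of_real t *s a + \<zeta> *s w))\<^sup>2 = t\<^sup>2 * (norm a)\<^sup>2 + (cmod \<zeta>)\<^sup>2 * (norm w)\<^sup>2"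
proof -
  have sq: "(norm v)\<^sup>2 = (\<Sum>k\<in>UNIV. (cmod (v $ k))\<^sup>2)" for v :: "complex ^ 'n"
    by (simp add: norm_vec_def L2_set_def sum_nonneg)
  have "(cmod (of_real t * x + \<zeta> * y))\<^sup>2 = t\<^sup>2 * (cmod x)\<^sup>2 + (cmod \<zeta>)\<^sup>2 * (cmod y)\<^sup>2 + 2 * t * Re (cnj \<zeta> * (x * cnj y))"
    for x y
    unfolding cmod_power2 by (simp add: power2_eq_square algebra_simps)
  then have "(norm (of_real t *s a + \<zeta> *s w))\<^sup>2 =
      t\<^sup>2 * (norm a)\<^sup>2 + (cmod \<zeta>)\<^sup>2 * (norm w)\<^sup>2 + (\<Sum>k\<in>UNIV. 2 * t * Re (cnj \<zeta> * (a $ k * cnj (w $ k))))"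
    unfolding sq by (simp add: sum.distrib sum_distrib_left)
  also have "(\<Sum>k\<in>UNIV. 2 * t * Re (cnj \<zeta> * (a $ k * cnj (w $ k)))) =
      2 * t * Re (cnj \<zeta> * (\<Sum>k\<in>UNIV. a $ k * cnj (w $ k)))"
    unfolding sum_distrib_left Re_sum ..
  finally show ?thesis by (simp add: assms)
qed

text \<open>The discs are parallel to a complex line tangent, at a point \<open>a\<close> of \<open>A\<close> furthest from the
  origin, to the sphere through \<open>a\<close>; they stay outside that sphere while their centres tend to
  \<open>a\<close>.\<close>

lemma not_pseudoconvex_diff_compact:
  fixes D A :: "(complex ^ 'n) set"
  assumes card: "CARD('n) \<ge> 2" and D: "open D" and A: "compact A" "A \<subseteq> D" "x \<in> A" "x \<noteq> 0"
  shows "\<not> pseudoconvex (D - A)"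
proof
  assume "pseudoconvex (D - A)"
  then obtain u where cont: "continuous_on (D - A) u"
    and mean: "\<And>z w. (\<lambda>\<zeta>. z + \<zeta> *s w) ` cball 0 1 \<subseteq> D - A \<Longrightarrow>
            u z \<le> 1 / (2 * pi) * integral {0..2 * pi} (\<lambda>\<theta>. u (z + cis \<theta> *s w))"
    and cpt: "\<And>c. compact {z \<in> D - A. u z \<le> c}"
    unfolding pseudoconvex_def continuous_plurisubharmonic_on_def by blast
  obtain a where a: "a \<in> A" "\<And>y. y \<in> A \<Longrightarrow> norm y \<le> norm a"
    using continuous_attains_sup[OF A(1) _ continuous_on_norm_id] A(3) by blast
  have "a \<noteq> 0" using a(2)[OF A(3)] A(4) by auto
  obtain w0 :: "complex ^ 'n" where w0: "w0 \<noteq> 0" "(\<Sum>k\<in>UNIV. a $ k * cnj (w0 $ k)) = 0"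
    using orthogonal_complex_vec[OF card \<open>a \<noteq> 0\<close>] by blast
  obtain \<rho> where \<rho>: "\<rho> > 0" "ball a \<rho> \<subseteq> D" using D A a openE by blast
  \<comment> \<open>With \<open>T = \<delta> / norm a\<close>, a centre moves by less than
    \<open>\<delta>\<close> and the disc adds at most \<open>\<delta>\<close>, so all discs stay in
    the ball of radius \<open>\<rho>\<close> about \<open>a\<close>.\<close>
  define \<delta> where "\<delta> = \<rho> / 2"
  define w where "w = of_real (\<delta> / norm w0) *s w0"
  have nw: "norm w = \<delta>"
    using w0(1) \<rho>(1) by (simp add: w_def norm_smult_complex_vec \<delta>_def norm_divide)
  have "\<delta> > 0" using \<rho>(1) by (simp add: \<delta>_def)
  define T where "T = \<delta> / norm a"
  have "T > 0" using \<open>a \<noteq> 0\<close> \<open>\<delta> > 0\<close> by (simp add: T_def)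
  have sq: "(norm (of_real t *s a + \<zeta> *s w))\<^sup>2 = t\<^sup>2 * (norm a)\<^sup>2 + (cmod \<zeta>)\<^sup>2 * \<delta>\<^sup>2" for t \<zeta>
  proof -
    have "\<zeta> *s w = (\<zeta> * of_real (\<delta> / norm w0)) *s w0" by (simp add: w_def)
    then have "(norm (of_real t *s a + \<zeta> *s w))\<^sup>2 =
        t\<^sup>2 * (norm a)\<^sup>2 + (cmod \<zeta>)\<^sup>2 * (\<delta> / norm w0)\<^sup>2 * (norm w0)\<^sup>2"
      using norm_add_orthogonal_complex_vec[OF w0(2), of t "\<zeta> * of_real (\<delta> / norm w0)"]
      by (simp add: norm_mult norm_divide power_mult_distrib power_divide)
    then show ?thesis using w0(1) by (simp add: power_divide)
  qed
  have mem: "of_real t *s a + \<zeta> *s w \<in> D - A"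
    if t: "1 \<le> t" "t < 1 + T" and \<zeta>: "cmod \<zeta> \<le> 1" and "t > 1 \<or> \<zeta> \<noteq> 0" for t \<zeta>
  proof
    have "of_real t *s a + \<zeta> *s w - a = of_real (t - 1) *s a + \<zeta> *s w"
      by (simp add: vec_eq_iff algebra_simps)
    then have "norm (of_real t *s a + \<zeta> *s w - a) \<le> norm (of_real (t - 1) *s a) + norm (\<zeta> *s w)"
      by (metis norm_triangle_ineq)
    also have "\<dots> = (t - 1) * norm a + cmod \<zeta> * \<delta>"
      unfolding norm_smult_complex_vec nw using t(1) by (simp flip: of_real_diff add: norm_of_real)
    also have "(t - 1) * norm a < \<delta>"
      using t(2) \<open>a \<noteq> 0\<close> by (simp add: T_def field_simps)
    also have "cmod \<zeta> * \<delta> \<le> \<delta>" using \<zeta> \<open>\<delta> > 0\<close> by simp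
    also have "\<delta> + \<delta> = \<rho>" by (simp add: \<delta>_def)
    finally show "of_real t *s a + \<zeta> *s w \<in> D"
      using \<rho>(2) by (auto simp: dist_norm norm_minus_commute)
    have "(norm a)\<^sup>2 < (norm (of_real t *s a + \<zeta> *s w))\<^sup>2"
    proof (cases "t > 1")
      case True
      then have "1\<^sup>2 < t\<^sup>2" by (intro power_strict_mono) auto
      then have "1 * (norm a)\<^sup>2 < t\<^sup>2 * (norm a)\<^sup>2"
        using \<open>a \<noteq> 0\<close> by (intro mult_strict_right_mono) auto
      moreover have "0 \<le> (cmod \<zeta>)\<^sup>2 * \<delta>\<^sup>2" by simp
      ultimately show ?thesis unfolding sq by linarith
    next
      case False
      then show ?thesis unfolding sq using that \<open>\<delta> > 0\<close> by simp
    qed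
    then have "norm a < norm (of_real t *s a + \<zeta> *s w)"
      by (rule power_less_imp_less_base) simp
    then show "of_real t *s a + \<zeta> *s w \<notin> A" using a(2) by force
  qed
  \<comment> \<open>The boundary circles of all the discs, including the limit disc
    \<open>t = 1\<close>: that disc meets \<open>A\<close> only at its centre, so \<open>H\<close>
    is compact in \<open>D - A\<close> and \<open>u\<close> has one upper bound \<open>c\<close> on
    it.\<close>
  define H where "H = (\<lambda>(t, \<theta>). of_real t *s a + cis \<theta> *s w) ` ({1..1 + T / 2} \<times> {0..2 * pi})"
  have contH: "continuous_on S (\<lambda>(t, \<theta>). of_real t *s a + cis \<theta> *s w)" for S
    unfolding split_def vector_scalar_mult_def cis_conv_exp
    by (intro continuous_intros)
  have "compact H"
    unfolding H_def by (intro compact_continuous_image contH compact_Times compact_Icc)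
  have HD: "H \<subseteq> D - A"
  proof
    fix y assume "y \<in> H"
    obtain p where p: "p \<in> {1..1 + T / 2} \<times> {0..2 * pi}"
        "y = (\<lambda>(t, \<theta>). of_real t *s a + cis \<theta> *s w) p"
      using \<open>y \<in> H\<close> unfolding H_def by (elim imageE) blast
    obtain t \<theta> where "p = (t, \<theta>)" by (cases p) blast
    with p have "t \<in> {1..1 + T / 2}" "y = of_real t *s a + cis \<theta> *s w" by simp_all
    then show "y \<in> D - A" using mem[of t "cis \<theta>"] \<open>T > 0\<close> by simp
  qed
  have "bounded (u ` H)"
    by (rule compact_imp_bounded[OF compact_continuous_image[OF continuous_on_subset[OF cont HD] \<open>compact H\<close>]])
  then obtain c where c: "\<And>y. y \<in> H \<Longrightarrow> u y \<le> c"
    unfolding bounded_real by (auto simp: abs_le_iff)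
  have low: "u (of_real t *s a) \<le> c" if t: "1 < t" "t \<le> 1 + T / 2" for t
  proof -
    let ?f = "\<lambda>\<theta>. u (of_real t *s a + cis \<theta> *s w)"
    have Hm: "of_real t *s a + cis \<theta> *s w \<in> H" if "\<theta> \<in> {0..2 * pi}" for \<theta>
      unfolding H_def using t that by (intro image_eqI[of _ _ "(t, \<theta>)"]) auto
    have "continuous_on {0..2 * pi} ?f"
    proof (rule continuous_on_compose2[OF cont])
      show "continuous_on {0..2 * pi} (\<lambda>\<theta>. of_real t *s a + cis \<theta> *s w)"
        unfolding vector_scalar_mult_def cis_conv_exp by (intro continuous_intros)
    qed (use Hm HD in blast)
    then have "?f integrable_on {0..2 * pi}" by (rule integrable_continuous_interval)
    then have "integral {0..2 * pi} ?f \<le> integral {0..2 * pi} (\<lambda>_. c)"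
      using c Hm by (intro integral_le) auto
    also have "\<dots> = 2 * pi * c" by simp
    finally have "1 / (2 * pi) * integral {0..2 * pi} ?f \<le> 1 / (2 * pi) * (2 * pi * c)"
      by (intro mult_left_mono) auto
    moreover have "u (of_real t *s a) \<le> 1 / (2 * pi) * integral {0..2 * pi} ?f"
      using t \<open>T > 0\<close> by (intro mean image_subsetI mem) auto
    ultimately show ?thesis by simp
  qed
  \<comment> \<open>By the mean value inequality the centres lie in a compact sublevel set of
    \<open>u\<close>; their limit \<open>a\<close> would belong to it, although \<open>a\<close> is
    in \<open>A\<close>.\<close>
  have "((\<lambda>t. complex_of_real t *s a) \<longlongrightarrow> complex_of_real 1 *s a) (at_right 1)"
    unfolding vector_scalar_mult_def by (intro tendsto_intros)
  moreover have "closed {z \<in> D - A. u z \<le> c}"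
    using cpt compact_imp_closed by blast
  moreover have "eventually (\<lambda>t. complex_of_real t *s a \<in> {z \<in> D - A. u z \<le> c}) (at_right 1)"
  proof (rule eventually_at_rightI[of 1 "1 + T / 2"])
    fix t assume t: "t \<in> {1<..<1 + T / 2}"
    then show "complex_of_real t *s a \<in> {z \<in> D - A. u z \<le> c}"
      using low[of t] mem[of t 0] \<open>T > 0\<close> by auto
  qed (use \<open>T > 0\<close> in simp)
  ultimately have "complex_of_real 1 *s a \<in> {z \<in> D - A. u z \<le> c}"
    by (intro Lim_in_closed_set[of _ _ "at_right 1"]) auto
  then show False using a(1) by simp
qed

text \<open>Points off \<open>A\<close> tending to \<open>a\<close> are Cauchy for the distance of
  \<open>D\<close>, hence for that of \<open>D - A\<close>. A Kobayashi limit in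
  \<open>D - A\<close> would have the same coordinates as \<open>a\<close> by
  \<open>kobayashi_dist_ge\<close>.\<close>

lemma not_kobayashi_complete_diff:
  fixes D A :: "(complex ^ 'n) set"
  assumes av: "avoidable A" and D: "is_domain D" "bounded D" and a: "a \<in> A" "a \<in> D"
  shows "\<not> kobayashi_complete (D - A)"
proof
  assume comp: "kobayashi_complete (D - A)"
  have oc: "open D" "connected D" using D by (auto simp: is_domain_def)
  obtain r where r: "r > 0" "ball a r \<subseteq> D" using oc(1) a openE by blast
  have "\<exists>z. norm (z - a) < min r (1 / real (Suc n)) \<and> z \<notin> A" for n
    using avoidable_point_near[OF av, of "min r (1 / real (Suc n))" a] r(1) by auto
  then obtain x where x: "\<And>n. norm (x n - a) < r" "\<And>n. norm (x n - a) < 1 / real (Suc n)" "\<And>n. x n \<notin> A"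
    by (metis min_less_iff_conj)
  have xD: "x n \<in> D - A" for n
    using x(1,3)[of n] r(2) by (auto simp: dist_norm norm_minus_commute)
  have lim: "x \<longlonglongrightarrow> a"
  proof (rule Lim_null[THEN iffD2], rule Lim_null_comparison)
    show "eventually (\<lambda>n. norm (x n - a) \<le> 1 / real (Suc n)) sequentially"
      using x(2) by (intro always_eventually) (auto intro: less_imp_le)
  qed (rule LIMSEQ_Suc[OF lim_1_over_n])
  have "\<exists>N. \<forall>m\<ge>N. \<forall>n\<ge>N. kobayashi_dist (D - A) (x m) (x n) < e" if "e > 0" for e
  proof -
    have "(artanh \<longlongrightarrow> artanh 0) (at_right (0::real))"
      using DERIV_isCont[OF artanh_real_has_field_derivative[of 0 UNIV]]
      unfolding isCont_def by (auto intro: tendsto_within_subset[where S = UNIV])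
    then have "eventually (\<lambda>t. artanh t < e) (at_right (0::real))"
      using \<open>e > 0\<close> by (intro order_tendstoD(2)) auto
    moreover have "eventually (\<lambda>t::real. t \<in> {0<..<1}) (at_right 0)"
      by (rule eventually_at_rightI[of 0 1]) auto
    ultimately have "eventually (\<lambda>t::real. artanh t < e \<and> t \<in> {0<..<1}) (at_right 0)"
      by (rule eventually_conj)
    then obtain t :: real where t: "artanh t < e" "0 < t" "t < 1"
      using eventually_happens'[OF trivial_limit_at_right_real] by (metis (mono_tags, lifting) greaterThanLessThan_iff)
    \<comment> \<open>Two points within \<open>d\<close> of \<open>a\<close> are less than
      \<open>t * (r / 2)\<close> apart, as \<open>disc_chain_ball\<close> requires in a ball of
      radius \<open>r / 2\<close> about one of them.\<close>
    define d where "d = t * (r / 2) / 2"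
    have "d > 0" using t r by (simp add: d_def)
    obtain N where N: "\<And>n. n \<ge> N \<Longrightarrow> norm (x n - a) < min d (r / 2)"
      using LIMSEQ_D[OF lim, of "min d (r / 2)"] \<open>d > 0\<close> r(1) by auto
    have "kobayashi_dist (D - A) (x m) (x n) < e" if mn: "m \<ge> N" "n \<ge> N" for m n
    proof -
      have "ball (x m) (r / 2) \<subseteq> D"
      proof
        fix y assume "y \<in> ball (x m) (r / 2)"
        then have "dist a y < r"
          using N[OF mn(1)] dist_triangle[of a y "x m"] by (simp add: dist_norm norm_minus_commute)
        then show "y \<in> D" using r(2) by auto
      qed
      moreover have "norm (x n - x m) \<le> t * (r / 2)"
        using norm_triangle_ineq4[of "x n - a" "x m - a"] N[OF mn(1)] N[OF mn(2)] by (simp add: d_def)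
      ultimately have "disc_chain D (x m) (x n) (artanh t)"
        using t r(1) by (intro disc_chain_ball(1)[of _ "r / 2"]) auto
      then have "kobayashi_dist D (x m) (x n) < e" using kobayashi_dist_le t(1) le_less_trans by blast
      then show ?thesis using kobayashi_dist_diff[OF av D(1) xD xD] by simp
    qed
    then show ?thesis by blast
  qed
  then obtain l where l: "l \<in> D - A" "(\<lambda>n. kobayashi_dist (D - A) (x n) l) \<longlonglongrightarrow> 0"
    using comp xD unfolding kobayashi_complete_def by (metis image_subsetI)
  obtain R where R: "R > 0" "D \<subseteq> ball 0 R"
    using bounded_subset_ballD[OF D(2), of 0] by auto
  have "a $ i = l $ i" for i
  proof -
    have "(\<lambda>n. 2 * R * kobayashi_dist (D - A) (x n) l) \<longlonglongrightarrow> 2 * R * 0"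
      by (intro tendsto_intros l)
    moreover have "cmod (x n $ i - l $ i) \<le> 2 * R * kobayashi_dist (D - A) (x n) l" for n
      using kobayashi_dist_ge[OF oc R(2,1), of "x n" l i] kobayashi_dist_diff[OF av D(1) xD l(1)] xD l(1)
      by auto
    ultimately have "(\<lambda>n. x n $ i - l $ i) \<longlonglongrightarrow> 0"
      by - (rule Lim_null_comparison[where g = "\<lambda>n. 2 * R * kobayashi_dist (D - A) (x n) l"], auto)
    moreover have "(\<lambda>n. x n $ i - l $ i) \<longlonglongrightarrow> a $ i - l $ i"
      by (intro tendsto_intros lim)
    ultimately show ?thesis using LIMSEQ_unique by force
  qed
  then have "a = l" by (simp add: vec_eq_iff)
  then show False using a l by blast
qed

section \<open>Limits of almost-geodesics\<close>

lemma infdist_frontier_ge: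
  assumes "open D" "frontier D \<noteq> {}" "ball z e \<subseteq> D"
  shows "e \<le> infdist z (frontier D)"
  using assms(2) unfolding infdist_notempty[OF assms(2)]
proof (rule cINF_greatest)
  fix y assume "y \<in> frontier D"
  then have "y \<notin> D" using assms(1) by (auto simp: frontier_def interior_open)
  then show "e \<le> dist z y" using assms(3) by (auto simp: not_le[symmetric] subset_iff)
qed

lemma frontier_bounded_nonempty:
  fixes D :: "(complex ^ 'n) set"
  assumes "bounded D" "D \<noteq> {}"
  shows "frontier D \<noteq> {}"
  using assms not_bounded_UNIV by (auto simp: frontier_eq_empty)

lemma almost_geodesic_diff:
  fixes D :: "(complex ^ 'n) set"
  assumes av: "avoidable A" and D: "is_domain D" and g: "almost_geodesic (D - A) L \<kappa> I \<sigma>"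
  shows "almost_geodesic D L \<kappa> I \<sigma>"
proof -
  have "open D" using D by (simp add: is_domain_def)
  have im: "\<sigma> t \<in> D - A" if "t \<in> I" for t
    using g that by (auto simp: almost_geodesic_def)
  have "AE t in lebesgue_on I. \<sigma> differentiable (at t within I) \<and>
        kobayashi_metric (D - A) (\<sigma> t) (vector_derivative \<sigma> (at t within I)) \<le> L"
    using g by (simp add: almost_geodesic_def)
  then have "AE t in lebesgue_on I. \<sigma> differentiable (at t within I) \<and>
        kobayashi_metric D (\<sigma> t) (vector_derivative \<sigma> (at t within I)) \<le> L"
    using AE_space
  proof eventually_elim
    case (elim t)
    then have "t \<in> I" by simp
    then show ?case using elim kobayashi_metric_diff[OF av \<open>open D\<close> im] by simp
  qed
  moreover have "kobayashi_dist (D - A) (\<sigma> s) (\<sigma> t) = kobayashi_dist D (\<sigma> s) (\<sigma> t)"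
    if "s \<in> I" "t \<in> I" for s t
    using kobayashi_dist_diff[OF av D im im] that by blast
  ultimately show ?thesis
    using g unfolding almost_geodesic_def by auto
qed

lemma almost_geodesic_lipschitz:
  fixes D :: "(complex ^ 'n) set"
  assumes "open D" "D \<subseteq> ball 0 R" "R > 0" "L \<ge> 1" and g: "almost_geodesic D L \<kappa> {a..b} \<sigma>"
  shows "(real CARD('n) * (2 * R) * L)-lipschitz_on {a..b} \<sigma>"
proof (rule absolutely_continuous_curve_lipschitz)
  show "absolutely_continuous_curve {a..b} \<sigma>" using g by (simp add: almost_geodesic_def)
  show "0 \<le> real CARD('n) * (2 * R) * L" using assms by simp
  have "AE t in lebesgue_on {a..b}. \<sigma> differentiable (at t within {a..b}) \<and>
        kobayashi_metric D (\<sigma> t) (vector_derivative \<sigma> (at t within {a..b})) \<le> L"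
    using g by (simp add: almost_geodesic_def)
  then show "AE t in lebesgue_on {a..b}. \<sigma> differentiable (at t within {a..b}) \<and>
      norm (vector_derivative \<sigma> (at t within {a..b})) \<le> real CARD('n) * (2 * R) * L"
    using AE_space
  proof eventually_elim
    case (elim t)
    then have "\<sigma> t \<in> D" using g by (auto simp: almost_geodesic_def)
    then have "norm (vector_derivative \<sigma> (at t within {a..b})) \<le>
        real CARD('n) * (2 * R) * kobayashi_metric D (\<sigma> t) (vector_derivative \<sigma> (at t within {a..b}))"
      by (rule kobayashi_metric_ge[OF assms(1-3)])
    also have "\<dots> \<le> real CARD('n) * (2 * R) * L"
      using elim assms(3) by (intro mult_left_mono) auto
    finally show ?case using elim by blast
  qed
qed

text \<open>The end points subconverge to frontier points of \<open>D\<close>, distinct because the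
  closures of \<open>V\<close> and \<open>W\<close> are disjoint. Visibility at these two points
  gives a compact set that the curves must hit, but it has positive distance from the
  frontier.\<close>

lemma visibility_domain_not_escaping:
  fixes D :: "(complex ^ 'n) set"
  assumes vis: "visibility_domain D" and L: "L \<ge> 1" "\<kappa> \<ge> 0"
    and g: "\<And>i. almost_geodesic D L \<kappa> {a i..b i} (\<sigma> i)" "\<And>i. a i \<le> b i"
    and near: "\<And>i t. t \<in> {a i..b i} \<Longrightarrow> infdist (\<sigma> i t) (frontier D) < \<epsilon> i"
    and \<epsilon>: "\<epsilon> \<longlonglongrightarrow> 0"
    and VW: "\<And>i. \<sigma> i (a i) \<in> V" "\<And>i. \<sigma> i (b i) \<in> W" "closure V \<inter> closure W = {}"
  shows False
proof -
  have D: "open D" "D \<noteq> {}" "bounded D"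
    using vis by (auto simp: visibility_domain_def is_domain_def)
  have ne: "frontier D \<noteq> {}" using frontier_bounded_nonempty D by blast
  have mem: "\<sigma> i t \<in> D" if "t \<in> {a i..b i}" for i t
    using g(1)[of i] that by (auto simp: almost_geodesic_def)
  define X where "X = (\<lambda>i. (\<sigma> i (a i), \<sigma> i (b i)))"
  have "compact (closure D \<times> closure D)"
    using D by (intro compact_Times) (auto simp: compact_closure)
  moreover have "\<forall>i. X i \<in> closure D \<times> closure D"
    using mem g(2) closure_subset by (fastforce simp: X_def)
  ultimately obtain l r where l: "strict_mono (r :: nat \<Rightarrow> nat)" "(X \<circ> r) \<longlonglongrightarrow> l"
    unfolding compact_def by metis
  obtain x y where xy: "l = (x, y)" by (cases l) blast
  have lx: "(\<lambda>i. \<sigma> (r i) (a (r i))) \<longlonglongrightarrow> x" and ly: "(\<lambda>i. \<sigma> (r i) (b (r i))) \<longlonglongrightarrow> y"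
    using tendsto_fst[OF l(2)] tendsto_snd[OF l(2)] by (simp_all add: xy X_def o_def)
  have \<epsilon>r: "(\<lambda>i. \<epsilon> (r i)) \<longlonglongrightarrow> 0"
    using LIMSEQ_subseq_LIMSEQ[OF \<epsilon> l(1)] by (simp add: o_def)
  have front: "p \<in> frontier D" if p: "q \<longlonglongrightarrow> p" "\<And>i. infdist (q i) (frontier D) < \<epsilon> (r i)" for p q
  proof -
    have "(\<lambda>i. infdist (q i) (frontier D)) \<longlonglongrightarrow> infdist p (frontier D)"
      by (intro tendsto_infdist p)
    moreover have "(\<lambda>i. infdist (q i) (frontier D)) \<longlonglongrightarrow> 0"
      by (rule tendsto_sandwich[OF _ _ tendsto_const \<epsilon>r])
        (auto intro!: always_eventually less_imp_le p simp: infdist_nonneg)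
    ultimately have "infdist p (frontier D) = 0" using LIMSEQ_unique by blast
    then show ?thesis using in_closed_iff_infdist_zero[OF frontier_closed ne] by simp
  qed
  have fr: "x \<in> frontier D" "y \<in> frontier D"
    using g(2) by (auto intro!: front[OF lx] front[OF ly] near)
  have "x \<in> closure V"
    by (rule Lim_in_closed_set[OF closed_closure _ _ lx])
      (use VW(1) closure_subset in \<open>auto intro!: always_eventually\<close>)
  moreover have "y \<in> closure W"
    by (rule Lim_in_closed_set[OF closed_closure _ _ ly])
      (use VW(2) closure_subset in \<open>auto intro!: always_eventually\<close>)
  ultimately have "x \<noteq> y" using VW(3) by blast
  \<comment> \<open>A third of the distance makes even the closed balls disjoint. \<open>V\<close>
    and \<open>W\<close> need not be open in \<open>closure D\<close>, so they are replaced by balls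
    around the limits.\<close>
  define \<delta> where "\<delta> = dist x y / 3"
  have "\<delta> > 0" using \<open>x \<noteq> y\<close> by (simp add: \<delta>_def)
  define V' where "V' = closure D \<inter> ball x \<delta>"
  define W' where "W' = closure D \<inter> ball y \<delta>"
  have "openin (top_of_set (closure D)) V'" "openin (top_of_set (closure D)) W'"
    unfolding V'_def W'_def by (auto intro: openin_open_Int)
  moreover have "x \<in> V'" "y \<in> W'"
    using fr \<open>\<delta> > 0\<close> by (auto simp: V'_def W'_def frontier_def)
  moreover have "closure V' \<inter> closure W' = {}"
  proof -
    have "closure V' \<subseteq> cball x \<delta>" "closure W' \<subseteq> cball y \<delta>"
      by (intro closure_minimal; force simp: V'_def W'_def)+
    moreover have "cball x \<delta> \<inter> cball y \<delta> = {}"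
      using \<open>x \<noteq> y\<close> by (intro disjoint_cballI) (simp add: \<delta>_def)
    ultimately show ?thesis by blast
  qed
  ultimately have "\<exists>K. compact K \<and> K \<subseteq> D \<and> (\<forall>\<sigma> a b. a \<le> b \<and> almost_geodesic D L \<kappa> {a..b} \<sigma> \<and>
      \<sigma> a \<in> V' \<and> \<sigma> b \<in> W' \<longrightarrow> \<sigma> ` {a..b} \<inter> K \<noteq> {})"
    using L fr \<open>x \<noteq> y\<close>
    by (intro vis[unfolded visibility_domain_def, THEN conjunct2, THEN conjunct2, rule_format, of L \<kappa> x y]) auto
  then obtain K where K: "compact K" "K \<subseteq> D"
      "\<And>\<sigma> a b. a \<le> b \<Longrightarrow> almost_geodesic D L \<kappa> {a..b} \<sigma> \<Longrightarrow> \<sigma> a \<in> V' \<Longrightarrow> \<sigma> b \<in> W' \<Longrightarrow> \<sigma> ` {a..b} \<inter> K \<noteq> {}"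
    by metis
  obtain e where e: "e > 0" "(\<Union>x\<in>K. ball x e) \<subseteq> D"
    using compact_subset_open_imp_ball_epsilon_subset[OF K(1) D(1) K(2)] by blast
  have "eventually (\<lambda>i. \<sigma> (r i) (a (r i)) \<in> ball x \<delta>) sequentially"
    using topological_tendstoD[OF lx open_ball] \<open>\<delta> > 0\<close> by simp
  moreover have "eventually (\<lambda>i. \<sigma> (r i) (b (r i)) \<in> ball y \<delta>) sequentially"
    using topological_tendstoD[OF ly open_ball] \<open>\<delta> > 0\<close> by simp
  moreover have "eventually (\<lambda>i. \<epsilon> (r i) < e) sequentially"
    using order_tendstoD(2)[OF \<epsilon>r e(1)] .
  ultimately have "eventually (\<lambda>i. False) sequentially"
  proof eventually_elim
    case (elim i)
    have "\<sigma> (r i) (a (r i)) \<in> V'" "\<sigma> (r i) (b (r i)) \<in> W'"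
      using elim mem[of _ "r i"] g(2)[of "r i"] closure_subset by (auto simp: V'_def W'_def)
    then obtain t where t: "t \<in> {a (r i)..b (r i)}" "\<sigma> (r i) t \<in> K"
      using K(3)[OF g(2) g(1)] by blast
    have "ball (\<sigma> (r i) t) e \<subseteq> D" using t(2) e(2) by blast
    then have "e \<le> infdist (\<sigma> (r i) t) (frontier D)"
      by (rule infdist_frontier_ge[OF D(1) ne])
    then show ?case using near[OF t(1)] elim(3) by linarith
  qed
  then show False by simp
qed

text \<open>Near a compact subset of \<open>D\<close> the Kobayashi distance is bounded, hence so are the parameter
  intervals; rescaled to \<open>[0, 1]\<close> the curves are uniformly Lipschitz.\<close>

lemma almost_geodesics_limit_path:
  fixes D A :: "(complex ^ 'n) set"
  assumes D: "is_domain D" "bounded D" and A: "compact A" "A \<subseteq> D" "A \<noteq> {}" and L: "L \<ge> 1"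
    and g: "\<And>i. almost_geodesic D L \<kappa> {a i..b i} (\<sigma> i)" "\<And>i. a i \<le> b i"
    and near: "\<And>i t. t \<in> {a i..b i} \<Longrightarrow> infdist (\<sigma> i t) A < \<epsilon> i"
    and \<epsilon>: "\<epsilon> \<longlonglongrightarrow> 0"
    and VW: "\<And>i. \<sigma> i (a i) \<in> V" "\<And>i. \<sigma> i (b i) \<in> W"
  obtains p where "path p" "path_image p \<subseteq> A" "pathstart p \<in> closure V" "pathfinish p \<in> closure W"
proof -
  have oc: "open D" "connected D" using D by (auto simp: is_domain_def)
  obtain R where R: "R > 0" "D \<subseteq> ball 0 R"
    using bounded_subset_ballD[OF D(2), of 0] by auto
  have mem: "\<sigma> i t \<in> D" if "t \<in> {a i..b i}" for i t
    using g(1)[of i] that by (auto simp: almost_geodesic_def)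
  obtain e where e: "e > 0" "(\<Union>x\<in>A. ball x e) \<subseteq> D"
    using compact_subset_open_imp_ball_epsilon_subset[OF A(1) oc(1) A(2)] by blast
  \<comment> \<open>A compact neighbourhood of \<open>A\<close> inside \<open>D\<close>; from index
    \<open>n0\<close> on the curves lie in it, which bounds the distance of their ends by
    \<open>B\<close>.\<close>
  define N where "N = {z. infdist z A \<le> e / 2}"
  have cN: "compact N" unfolding N_def using A e by (intro compact_infdist_le) auto
  have "N \<subseteq> D"
  proof
    fix z assume "z \<in> N"
    obtain x where "x \<in> A" "infdist z A = dist z x"
      using infdist_attains_inf[OF compact_imp_closed[OF A(1)] A(3)] by blast
    then have "z \<in> ball x e" using \<open>z \<in> N\<close> e(1) by (simp add: N_def dist_commute)
    then show "z \<in> D" using e(2) \<open>x \<in> A\<close> by blast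
  qed
  obtain B where B: "\<And>x y. x \<in> N \<Longrightarrow> y \<in> N \<Longrightarrow> kobayashi_dist D x y \<le> B"
    using kobayashi_dist_bounded_on_compact[OF oc cN \<open>N \<subseteq> D\<close>] by blast
  obtain n0 where n0: "\<And>i. i \<ge> n0 \<Longrightarrow> \<epsilon> i < e / 2"
    using order_tendstoD(2)[OF \<epsilon>, of "e / 2"] e(1) by (auto simp: eventually_sequentially)
  \<comment> \<open>Solving the lower almost-geodesic inequality, with \<open>B\<close> as upper
    bound for the distance, for the length of the parameter interval.\<close>
  define T where "T = L * (B + \<kappa>)"
  have len: "b i - a i \<le> T" if i: "i \<ge> n0" for i
  proof -
    have ab: "a i \<in> {a i..b i}" "b i \<in> {a i..b i}" using g(2) by auto
    have "\<bar>b i - a i\<bar> / L - \<kappa> \<le> kobayashi_dist D (\<sigma> i (a i)) (\<sigma> i (b i))"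
      using g(1)[of i] ab unfolding almost_geodesic_def by blast
    also have "\<dots> \<le> B"
      using near[OF ab(1)] near[OF ab(2)] n0[OF i] by (intro B) (auto simp: N_def)
    finally show ?thesis using L g(2)[of i] by (simp add: T_def field_simps)
  qed
  have "T \<ge> 0" using len[OF order_refl] g(2)[of n0] by linarith
  define M where "M = real CARD('n) * (2 * R) * L"
  have "M \<ge> 0" using R L by (simp add: M_def)
  define s where "s = (\<lambda>i u. a (i + n0) + u * (b (i + n0) - a (i + n0)))"
  define \<tau> where "\<tau> = (\<lambda>i u. \<sigma> (i + n0) (s i u))"
  have s: "s i u \<in> {a (i + n0)..b (i + n0)}" if "u \<in> {0..1}" for i u
  proof -
    have "u * (b (i + n0) - a (i + n0)) \<le> 1 * (b (i + n0) - a (i + n0))"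
      using that g(2)[of "i + n0"] by (intro mult_right_mono) auto
    moreover have "0 \<le> u * (b (i + n0) - a (i + n0))"
      using that g(2)[of "i + n0"] by simp
    ultimately show ?thesis by (simp add: s_def)
  qed
  have lip: "norm (\<tau> i u - \<tau> i v) \<le> M * T * \<bar>u - v\<bar>" if uv: "u \<in> {0..1}" "v \<in> {0..1}" for i u v
  proof -
    have "M-lipschitz_on {a (i + n0)..b (i + n0)} (\<sigma> (i + n0))"
      unfolding M_def using almost_geodesic_lipschitz[OF oc(1) R(2,1) L g(1)] .
    then have "dist (\<tau> i u) (\<tau> i v) \<le> M * dist (s i u) (s i v)"
      unfolding \<tau>_def using s uv by (intro lipschitz_onD) auto
    also have "dist (s i u) (s i v) = \<bar>u - v\<bar> * (b (i + n0) - a (i + n0))"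
    proof -
      have "s i u - s i v = (u - v) * (b (i + n0) - a (i + n0))" by (simp add: s_def algebra_simps)
      then show ?thesis using g(2)[of "i + n0"] by (simp add: dist_real_def abs_mult)
    qed
    also have "M * (\<bar>u - v\<bar> * (b (i + n0) - a (i + n0))) \<le> M * (\<bar>u - v\<bar> * T)"
      using len[of "i + n0"] \<open>M \<ge> 0\<close> by (intro mult_left_mono) auto
    finally show ?thesis by (simp add: dist_norm mult_ac)
  qed
  obtain p k where p: "continuous_on {0..1} p" "strict_mono (k :: nat \<Rightarrow> nat)"
      "\<And>e. 0 < e \<Longrightarrow> \<exists>N. \<forall>n x. n \<ge> N \<and> x \<in> {0..1} \<longrightarrow> norm (\<tau> (k n) x - p x) < e"
  proof (rule Arzela_Ascoli[of "{0..1::real}" \<tau> R])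
    show "norm (\<tau> i u) \<le> R" if "u \<in> {0..1}" for i u
      using mem[OF s[OF that]] R(2) by (auto simp: \<tau>_def subset_iff intro: less_imp_le)
    fix u e' :: real assume u: "u \<in> {0..1}" "e' > 0"
    \<comment> \<open>The added 1 gives a usable modulus of equicontinuity also when
      \<open>M * T = 0\<close>.\<close>
    have pos: "M * T + 1 > 0" using \<open>M \<ge> 0\<close> \<open>T \<ge> 0\<close> by (simp add: add_nonneg_pos)
    have "norm (\<tau> n u - \<tau> n v) < e'" if v: "v \<in> {0..1}" "norm (u - v) < e' / (M * T + 1)" for n v
    proof -
      have "norm (\<tau> n u - \<tau> n v) \<le> (M * T + 1) * \<bar>u - v\<bar>"
        using lip[OF u(1) v(1), of n] by (simp add: algebra_simps)
      also have "\<dots> < (M * T + 1) * (e' / (M * T + 1))"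
        using v(2) pos by (intro mult_strict_left_mono) auto
      finally show ?thesis using pos by simp
    qed
    then show "\<exists>d>0. \<forall>n v. v \<in> {0..1} \<and> norm (u - v) < d \<longrightarrow> norm (\<tau> n u - \<tau> n v) < e'"
      using pos u(2) by (intro exI[of _ "e' / (M * T + 1)"]) auto
  qed auto
  have lim: "(\<lambda>n. \<tau> (k n) u) \<longlonglongrightarrow> p u" if u: "u \<in> {0..1}" for u
    using p(3) u by (intro LIMSEQ_I) blast
  have \<epsilon>k: "(\<lambda>n. \<epsilon> (k n + n0)) \<longlonglongrightarrow> 0"
    using LIMSEQ_subseq_LIMSEQ[OF LIMSEQ_ignore_initial_segment[OF \<epsilon>, of n0] p(2)] by (simp add: o_def)
  have pA: "p u \<in> A" if u: "u \<in> {0..1}" for u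
  proof -
    have "(\<lambda>n. infdist (\<tau> (k n) u) A) \<longlonglongrightarrow> infdist (p u) A"
      by (intro tendsto_infdist lim u)
    moreover have "(\<lambda>n. infdist (\<tau> (k n) u) A) \<longlonglongrightarrow> 0"
      using near[OF s[OF u]]
      by (intro tendsto_sandwich[OF _ _ tendsto_const \<epsilon>k])
        (auto intro!: always_eventually less_imp_le simp: infdist_nonneg \<tau>_def)
    ultimately have "infdist (p u) A = 0" using LIMSEQ_unique by blast
    then show ?thesis using in_closed_iff_infdist_zero[OF compact_imp_closed[OF A(1)] A(3)] by simp
  qed
  show ?thesis
  proof (rule that)
    show "path p" using p(1) by (simp add: path_def)
    show "path_image p \<subseteq> A" using pA by (auto simp: path_image_def)
    have "\<tau> i 0 \<in> closure V" "\<tau> i 1 \<in> closure W" for i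
      using VW closure_subset by (auto simp: \<tau>_def s_def)
    then show "pathstart p \<in> closure V" "pathfinish p \<in> closure W"
      unfolding pathstart_def pathfinish_def
      using Lim_in_closed_set[OF closed_closure always_eventually _ lim[of 0], of V]
        Lim_in_closed_set[OF closed_closure always_eventually _ lim[of 1], of W]
      by auto
  qed
qed

text \<open>A curve missing \<open>K n\<close> is at each parameter within
  \<open>\<epsilon> n\<close> of \<open>A\<close> or of the frontier of \<open>D\<close>. For large
  \<open>n\<close> these neighbourhoods are disjoint, so connectedness puts the whole curve into one
  of them. One alternative occurs infinitely often: near \<open>A\<close> the limit path contradicts
  \<open>no_path\<close>, near the frontier the visibility of \<open>D\<close> is
  contradicted.\<close>

theorem visibility_domain_diff:
  fixes D A :: "(complex ^ 'n) set"
  assumes av: "avoidable A" and A: "compact A" "A \<subseteq> D" "A \<noteq> {}"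
    and vis: "visibility_domain D"
    and no_path: "\<And>p. path p \<Longrightarrow> path_image p \<subseteq> A \<Longrightarrow> pathstart p = pathfinish p"
  shows "visibility_domain (D - A)"
proof -
  have D: "is_domain D" "bounded D" using vis by (auto simp: visibility_domain_def)
  then have oc: "open D" "D \<noteq> {}" by (auto simp: is_domain_def)
  have ne: "frontier D \<noteq> {}" using frontier_bounded_nonempty[OF D(2) oc(2)] .
  obtain e where e: "e > 0" "(\<Union>x\<in>A. ball x e) \<subseteq> D"
    using compact_subset_open_imp_ball_epsilon_subset[OF A(1) oc(1) A(2)] by blast
  \<comment> \<open>\<open>A\<close> keeps distance \<open>e\<close> from the complement of
    \<open>D\<close>, so a point closer than \<open>e / 2\<close> to \<open>A\<close> has a ball of
    radius \<open>e / 2\<close> inside \<open>D\<close>.\<close>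
  have sep: "e / 2 \<le> infdist z (frontier D)" if z: "infdist z A < e / 2" for z
  proof (rule infdist_frontier_ge[OF oc(1) ne], rule subsetI)
    fix y assume y: "y \<in> ball z (e / 2)"
    obtain x where x: "x \<in> A" "infdist z A = dist z x"
      using infdist_attains_inf[OF compact_imp_closed[OF A(1)] A(3)] by blast
    have "dist x y < e"
      using z x(2) y dist_triangle[of x y z] by (simp add: dist_commute)
    then have "y \<in> ball x e" by simp
    then show "y \<in> D" using e(2) x(1) by blast
  qed
  have exK: "\<exists>K. compact K \<and> K \<subseteq> D - A \<and>
             (\<forall>\<sigma> a b. a \<le> b \<and> almost_geodesic (D - A) L \<kappa> {a..b} \<sigma> \<and> \<sigma> a \<in> V \<and> \<sigma> b \<in> W \<longrightarrow>
                      \<sigma> ` {a..b} \<inter> K \<noteq> {})"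
    if L: "L \<ge> 1" "\<kappa> \<ge> 0" and VW: "closure V \<inter> closure W = {}" for L \<kappa> V W
  proof (rule ccontr)
    assume contra: "\<nexists>K. compact K \<and> K \<subseteq> D - A \<and>
             (\<forall>\<sigma> a b. a \<le> b \<and> almost_geodesic (D - A) L \<kappa> {a..b} \<sigma> \<and> \<sigma> a \<in> V \<and> \<sigma> b \<in> W \<longrightarrow>
                      \<sigma> ` {a..b} \<inter> K \<noteq> {})"
    define \<epsilon> where "\<epsilon> = (\<lambda>n. 1 / real (Suc n))"
    have \<epsilon>: "\<epsilon> \<longlonglongrightarrow> 0" unfolding \<epsilon>_def by (rule LIMSEQ_Suc[OF lim_1_over_n])
    have \<epsilon>_pos: "\<epsilon> n > 0" for n by (simp add: \<epsilon>_def)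
    define K where "K = (\<lambda>n. closure D \<inter> {z. \<epsilon> n \<le> infdist z (frontier D)} \<inter> {z. \<epsilon> n \<le> infdist z A})"
    have "compact (K n)" for n
      unfolding K_def using D(2)
      by (intro compact_Int_closed closed_Collect_le continuous_intros) (auto simp: compact_closure)
    moreover have "K n \<subseteq> D - A" for n
    proof
      fix z assume z: "z \<in> K n"
      then have "infdist z (frontier D) \<noteq> 0" "infdist z A \<noteq> 0"
        using \<epsilon>_pos[of n] by (auto simp: K_def)
      then have "z \<notin> frontier D" "z \<notin> A" by (auto dest: infdist_zero)
      then show "z \<in> D - A" using z oc(1) by (auto simp: K_def frontier_def interior_open)
    qed
    ultimately have "\<forall>n. \<exists>\<sigma> a b. a \<le> b \<and> almost_geodesic (D - A) L \<kappa> {a..b} \<sigma> \<and> \<sigma> a \<in> V \<and> \<sigma> b \<in> W \<and>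
        \<sigma> ` {a..b} \<inter> K n = {}"
      using contra by meson
    then obtain \<sigma> a b where \<sigma>: "\<And>n. a n \<le> b n" "\<And>n. almost_geodesic (D - A) L \<kappa> {a n..b n} (\<sigma> n)"
        "\<And>n. \<sigma> n (a n) \<in> V" "\<And>n. \<sigma> n (b n) \<in> W" "\<And>n. \<sigma> n ` {a n..b n} \<inter> K n = {}"
      by metis
    have gD: "almost_geodesic D L \<kappa> {a n..b n} (\<sigma> n)" for n
      by (rule almost_geodesic_diff[OF av D(1) \<sigma>(2)])
    obtain R where R: "R > 0" "D \<subseteq> ball 0 R"
      using bounded_subset_ballD[OF D(2), of 0] by auto
    define near far where
      "near = {n. \<forall>t\<in>{a n..b n}. infdist (\<sigma> n t) A < \<epsilon> n}" and
      "far = {n. \<forall>t\<in>{a n..b n}. infdist (\<sigma> n t) (frontier D) < \<epsilon> n}"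
    obtain n0 where n0: "\<And>n. n \<ge> n0 \<Longrightarrow> \<epsilon> n < e / 2"
      using order_tendstoD(2)[OF \<epsilon>, of "e / 2"] e(1) by (auto simp: eventually_sequentially)
    have "n \<in> near \<union> far" if n: "n \<ge> n0" for n
    proof -
      define U1 where "U1 = {z. infdist z (frontier D) < \<epsilon> n}"
      define U2 where "U2 = {z. infdist z A < \<epsilon> n}"
      have "connected (\<sigma> n ` {a n..b n})"
        using almost_geodesic_lipschitz[OF oc(1) R(2,1) L(1) gD]
        by (intro connected_continuous_image lipschitz_on_continuous_on) auto
      moreover have "open U1" "open U2"
        unfolding U1_def U2_def by (intro open_Collect_less continuous_intros)+
      moreover have "U1 \<inter> U2 \<inter> \<sigma> n ` {a n..b n} = {}"
      proof -
        have False if "infdist z (frontier D) < \<epsilon> n" "infdist z A < \<epsilon> n" for z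
          using sep[of z] n0[OF n] that by linarith
        then show ?thesis by (auto simp: U1_def U2_def)
      qed
      moreover have "\<sigma> n ` {a n..b n} \<subseteq> U1 \<union> U2"
      proof
        fix z assume z: "z \<in> \<sigma> n ` {a n..b n}"
        then have "z \<in> closure D"
          using gD[of n] closure_subset by (auto simp: almost_geodesic_def)
        then show "z \<in> U1 \<union> U2"
          using z \<sigma>(5)[of n] by (auto simp: K_def U1_def U2_def not_le[symmetric])
      qed
      ultimately have "U1 \<inter> \<sigma> n ` {a n..b n} = {} \<or> U2 \<inter> \<sigma> n ` {a n..b n} = {}"
        by (rule connectedD)
      with \<open>\<sigma> n ` {a n..b n} \<subseteq> U1 \<union> U2\<close> have "\<sigma> n ` {a n..b n} \<subseteq> U2 \<or> \<sigma> n ` {a n..b n} \<subseteq> U1"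
        by blast
      then show ?thesis by (auto simp: near_def far_def U1_def U2_def)
    qed
    then have "{n0..} \<subseteq> near \<union> far" by auto
    then have "infinite near \<or> infinite far"
      using infinite_Ici[of n0] finite_subset by blast
    then show False
    proof
      assume "infinite near"
      then obtain s :: "nat \<Rightarrow> nat" where s: "strict_mono s" "\<And>n. s n \<in> near"
        using infinite_enumerate by metis
      have lim: "(\<lambda>i. \<epsilon> (s i)) \<longlonglongrightarrow> 0"
        using LIMSEQ_subseq_LIMSEQ[OF \<epsilon> s(1)] by (simp add: o_def)
      have close: "infdist (\<sigma> (s i) t) A < \<epsilon> (s i)" if "t \<in> {a (s i)..b (s i)}" for i t
        using s(2)[of i] that by (simp add: near_def)
      obtain p where p: "path p" "path_image p \<subseteq> A" "pathstart p \<in> closure V" "pathfinish p \<in> closure W"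
        using almost_geodesics_limit_path[where a = "\<lambda>i. a (s i)" and b = "\<lambda>i. b (s i)" and
              \<sigma> = "\<lambda>i. \<sigma> (s i)" and \<epsilon> = "\<lambda>i. \<epsilon> (s i)",
              OF D A L(1) gD \<sigma>(1) close lim \<sigma>(3) \<sigma>(4)]
        by blast
      then show False using no_path[OF p(1,2)] VW by auto
    next
      assume "infinite far"
      then obtain s :: "nat \<Rightarrow> nat" where s: "strict_mono s" "\<And>n. s n \<in> far"
        using infinite_enumerate by metis
      have lim: "(\<lambda>i. \<epsilon> (s i)) \<longlonglongrightarrow> 0"
        using LIMSEQ_subseq_LIMSEQ[OF \<epsilon> s(1)] by (simp add: o_def)
      have close: "infdist (\<sigma> (s i) t) (frontier D) < \<epsilon> (s i)" if "t \<in> {a (s i)..b (s i)}" for i t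
        using s(2)[of i] that by (simp add: far_def)
      show False
        by (rule visibility_domain_not_escaping[where a = "\<lambda>i. a (s i)" and b = "\<lambda>i. b (s i)" and
              \<sigma> = "\<lambda>i. \<sigma> (s i)" and \<epsilon> = "\<lambda>i. \<epsilon> (s i)",
              OF vis L gD \<sigma>(1) close lim \<sigma>(3) \<sigma>(4) VW])
    qed
  qed
  show ?thesis
    unfolding visibility_domain_def
  proof (intro conjI)
    show "is_domain (D - A)"
      by (rule is_domain_diff[OF av compact_imp_closed[OF A(1)] D(1)])
    show "bounded (D - A)" using D(2) by (rule bounded_subset) auto
  qed (use exK in meson)
qed

theorem corollary1p5:
  fixes D A :: "(complex ^ 'n) set"
    and P :: "(real ^ 2) set"
    and \<psi> :: "real ^ 2 \<Rightarrow> complex ^ 'n"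
  assumes "CARD('n) \<ge> 3"
    and "bounded D" and "visibility_domain D"
    and "pseudo_arc P"
    and "bi_lipschitz_on P \<psi>"
    and "A = \<psi> ` P" and "A \<subset> D"
  shows "visibility_domain (D - A) \<and> \<not> pseudoconvex (D - A) \<and> \<not> kobayashi_complete (D - A)"
proof -
  obtain L where L: "L-lipschitz_on P \<psi>" using assms(5) by (auto simp: bi_lipschitz_on_def)
  have av: "avoidable A"
    unfolding assms(6) by (rule avoidable_lipschitz_image[OF assms(1) L])
  have D: "is_domain D" "open D" using assms(3) by (auto simp: visibility_domain_def is_domain_def)
  have "compact A"
    unfolding assms(6) using assms(4) lipschitz_on_continuous_on[OF L]
    by (intro compact_continuous_image) (auto simp: pseudo_arc_def)
  have sub: "A \<subseteq> D" using assms(7) by blast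
  obtain x y where xy: "x \<in> P" "y \<in> P" "x \<noteq> y" using assms(4) by (auto simp: pseudo_arc_def)
  have "\<psi> x \<noteq> \<psi> y"
    using assms(5) xy by (auto simp: bi_lipschitz_on_def dest: inj_onD)
  \<comment> \<open>Of two distinct points one is nonzero. Hence the point of \<open>A\<close>
    furthest from the origin is nonzero, and the sphere used against pseudoconvexity is not
    degenerate.\<close>
  then obtain z where z: "z \<in> A" "z \<noteq> 0"
    using xy assms(6) by (metis image_eqI)
  have "visibility_domain (D - A)"
  proof (rule visibility_domain_diff[OF av \<open>compact A\<close> sub _ assms(3)])
    show "A \<noteq> {}" using z by blast
    show "pathstart p = pathfinish p" if "path p" "path_image p \<subseteq> A" for p
      using bi_lipschitz_pseudo_arc_no_path[OF assms(4,5)] that assms(6) by blast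
  qed
  moreover have "\<not> pseudoconvex (D - A)"
    using assms(1) by (intro not_pseudoconvex_diff_compact[OF _ D(2) \<open>compact A\<close> sub z]) auto
  moreover have "\<not> kobayashi_complete (D - A)"
    using sub z by (intro not_kobayashi_complete_diff[OF av D(1) assms(2) z(1)]) auto
  ultimately show ?thesis by blast
qed

end
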